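(* Let $Q(x,y,z)$ be an irreducible complex quadratic form and let $P(x,y,z)$ be any complex polynomial of degree $d$. (1) The restriction of $P$ to the complex surface $\mathcal S=\{Q(x,y,z)=1\}$ admits a representation of the form $$P(x,y,z)=\lambda_0+\sum_{k=1}^d\ \prod_{l=1}^kL_{k,l}(x,y,z),$$ where $\lambda_0\in\mathbb C$ and the linear forms $L_{k,l}$ are chosen so that each non-zero product $\prod_{l=1}^kL_{k,l}$ is determined by an appropriate multipole $w_k\in\mathcal M(k)$ (via the map $\Phi_Q$). (2) This representation is unique up to a finite ambiguity and up to reordering and rescaling of the multipliers in each product $\prod_{l=1}^kL_{k,l}$. In other words, the set of $P$-representing sequences of multipoles $\{w_k\in\overline{\mathcal M}(k)\}_{1\le k\le d}$ is finite, and its cardinality does not exceed $\prod_{k=1}^d[(2k-1)!!]$.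
   Context: $V(1)$ is the space of complex linear forms in $x,y,z$ and $V(1)^\circ=V(1)\setminus\{0\}$. The multipole space is $\mathcal M(k)=[V(1)^\circ]^k/\Sigma_k$, where $\Sigma_k$ is generated by the permutations $S_k$ of the factors and by the group $H_k=\{(\lambda_\nu)\in(\mathbb C^\ast)^k:\prod_\nu\lambda_\nu=1\}$ acting by rescaling; a multipole $w\in\mathcal M(k)$, the class of $(L_1,\dots,L_k)$, determines the product $\Theta(w)=\prod_\nu L_\nu$, a homogeneous polynomial of degree $k$. $\overline{\mathcal M}(k)=\mathcal M(k)\cup\{\mathbf 0\}$, where the zero multipole $\mathbf 0$ represents the zero product. $\Phi_Q:\mathcal M(k)\to (V(k)/V_Q(k))\setminus\{0\}$ sends $w$ to $\Theta(w)$ modulo $V_Q(k)$, where $V(k)$ is the space of homogeneous polynomials of degree $k$ and $V_Q(k)$ is the subspace of those divisible by $Q$. A sequence $(w_k)_{1\le k\le d}$ is $P$-representing if $P|_{\mathcal S}=\big(\lambda_0+\sum_{k=1}^d\Theta(w_k)\big)|_{\mathcal S}$ for some $\lambda_0\in\mathbb C$. *)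

theory Defs
  imports
    "HOL-Analysis.Finite_Cartesian_Product"
    "HOL-Library.Poly_Mapping"
    "HOL-Library.FuncSet"
    "HOL-Computational_Algebra.Factorial_Ring"
    "HOL-Combinatorics.Permutations"
begin

text \<open>
  \<open>\<complex>[x, y, z]\<close> is the monoid algebra of the exponent vectors \<open>3 \<Rightarrow>\<^sub>0 nat\<close>; its ring structure,
  divisibility and \<open>irreducible\<close> are those of the library.
\<close>

type_synonym poly3 = "(3 \<Rightarrow>\<^sub>0 nat) \<Rightarrow>\<^sub>0 complex"

definition mono_degree :: "(3 \<Rightarrow>\<^sub>0 nat) \<Rightarrow> nat" where
  "mono_degree m = (\<Sum>i\<in>UNIV. Poly_Mapping.lookup m i)"

text \<open>The zero polynomial has total degree \<open>0\<close> here.\<close>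

definition total_deg :: "poly3 \<Rightarrow> nat" where
  "total_deg p = Max (insert 0 (mono_degree ` Poly_Mapping.keys p))"

definition Const :: "complex \<Rightarrow> poly3" where
  "Const c = Poly_Mapping.single 0 c"

definition eval :: "poly3 \<Rightarrow> complex ^ 3 \<Rightarrow> complex" where
  "eval p v = (\<Sum>m\<in>Poly_Mapping.keys p.
     Poly_Mapping.lookup p m * (\<Prod>i\<in>UNIV. (v $ i) ^ Poly_Mapping.lookup m i))"

definition V :: "nat \<Rightarrow> poly3 set" where
  "V k = {p. \<forall>m\<in>Poly_Mapping.keys p. mono_degree m = k}"

definition V_Q :: "poly3 \<Rightarrow> nat \<Rightarrow> poly3 set" where
  "V_Q Q k = {p \<in> V k. Q dvd p}"

definition cong_Q :: "poly3 \<Rightarrow> nat \<Rightarrow> (poly3 \<times> poly3) set" where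
  "cong_Q Q k = {(f, g). f \<in> V k \<and> g \<in> V k \<and> f - g \<in> V_Q Q k}"

definition quot_Q :: "poly3 \<Rightarrow> nat \<Rightarrow> poly3 set set" where
  "quot_Q Q k = V k // cong_Q Q k"

definition class_Q :: "poly3 \<Rightarrow> nat \<Rightarrow> poly3 \<Rightarrow> poly3 set" where
  "class_Q Q k f = cong_Q Q k `` {f}"

definition level_surface :: "poly3 \<Rightarrow> (complex ^ 3) set" where
  "level_surface Q = {v. eval Q v = 1}"

text \<open>
  \<open>tuples k\<close> is \<open>[V(1) - {0}]\<^sup>k\<close>, with tuples as extensional functions on \<open>{1..k}\<close>.  The orbit
  relation of the group generated by the permutations and the rescalings is the reflexive
  transitive closure of the two families of moves, as each family is closed under inverses.
\<close>

definition tuples :: "nat \<Rightarrow> (nat \<Rightarrow> poly3) set" where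
  "tuples k = {1..k} \<rightarrow>\<^sub>E (V 1 - {0})"

definition permute_moves :: "nat \<Rightarrow> ((nat \<Rightarrow> poly3) \<times> (nat \<Rightarrow> poly3)) set" where
  "permute_moves k = {(L, L \<circ> \<pi>) | L \<pi>. L \<in> tuples k \<and> \<pi> permutes {1..k}}"

definition rescale_moves :: "nat \<Rightarrow> ((nat \<Rightarrow> poly3) \<times> (nat \<Rightarrow> poly3)) set" where
  "rescale_moves k = {(L, \<lambda>l\<in>{1..k}. Const (c l) * L l) | L c.
     L \<in> tuples k \<and> (\<forall>l\<in>{1..k}. c l \<noteq> 0) \<and> (\<Prod>l\<in>{1..k}. c l) = 1}"

definition multipole_rel :: "nat \<Rightarrow> ((nat \<Rightarrow> poly3) \<times> (nat \<Rightarrow> poly3)) set" where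
  "multipole_rel k = Restr ((permute_moves k \<union> rescale_moves k)\<^sup>*) (tuples k)"

type_synonym multipole = "(nat \<Rightarrow> poly3) set"

definition multipoles :: "nat \<Rightarrow> multipole set" where
  "multipoles k = tuples k // multipole_rel k"

text \<open>The product is constant on each class; see \<open>Theta_class\<close> below.\<close>

definition Theta :: "nat \<Rightarrow> multipole \<Rightarrow> poly3" where
  "Theta k w = the_elem ((\<lambda>L. \<Prod>l\<in>{1..k}. L l) ` w)"

definition Phi :: "poly3 \<Rightarrow> nat \<Rightarrow> multipole \<Rightarrow> poly3 set" where
  "Phi Q k w = class_Q Q k (Theta k w)"

text \<open>\<open>None\<close> is the zero multipole.\<close>

definition multipoles0 :: "nat \<Rightarrow> multipole option set" where
  "multipoles0 k = insert None (Some ` multipoles k)"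

definition Theta0 :: "nat \<Rightarrow> multipole option \<Rightarrow> poly3" where
  "Theta0 k w = (case w of None \<Rightarrow> 0 | Some u \<Rightarrow> Theta k u)"

definition representing_seqs :: "poly3 \<Rightarrow> poly3 \<Rightarrow> nat \<Rightarrow> (nat \<Rightarrow> multipole option) set" where
  "representing_seqs Q P d = {w \<in> (\<Pi>\<^sub>E k\<in>{1..d}. multipoles0 k).
     \<exists>c. \<forall>v\<in>level_surface Q. eval P v = eval (Const c + (\<Sum>k\<in>{1..d}. Theta0 k (w k))) v}"

text \<open>\<open>(2k - 1)!!\<close>\<close>

definition odd_double_fact :: "nat \<Rightarrow> nat" where
  "odd_double_fact k = (\<Prod>j\<in>{1..k}. 2 * j - 1)"


lemma Const_1: "Const 1 = 1"
  by (simp add: Const_def)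

lemma Const_mult: "Const (a * b) = Const a * Const b"
  by (simp add: Const_def mult_single)

lemma prod_Const: "(\<Prod>l\<in>A. Const (c l)) = Const (\<Prod>l\<in>A. c l)"
  by (induction A rule: infinite_finite_induct) (simp_all add: Const_1 Const_mult)

lemma moves_prod:
  assumes "(L, L') \<in> permute_moves k \<union> rescale_moves k"
  shows "(\<Prod>l\<in>{1..k}. L' l) = (\<Prod>l\<in>{1..k}. L l)"
proof -
  consider (p) \<pi> where "L' = L \<circ> \<pi>" "\<pi> permutes {1..k}"
    | (r) c where "L' = (\<lambda>l\<in>{1..k}. Const (c l) * L l)" "(\<Prod>l\<in>{1..k}. c l) = 1"
    using assms by (auto simp: permute_moves_def rescale_moves_def)
  then show ?thesis
  proof cases
    case p
    then show ?thesis using prod.permute[of \<pi> "{1..k}" L] by (simp only:)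
  next
    case r
    then have "(\<Prod>l\<in>{1..k}. L' l) = (\<Prod>l\<in>{1..k}. Const (c l)) * (\<Prod>l\<in>{1..k}. L l)"
      by (simp add: prod.distrib)
    then show ?thesis using r(2) by (simp only: prod_Const Const_1 mult_1_left)
  qed
qed

lemma sym_moves: "sym (permute_moves k \<union> rescale_moves k)"
proof (rule symI)
  fix L L' assume "(L, L') \<in> permute_moves k \<union> rescale_moves k"
  then consider (p) \<pi> where "L' = L \<circ> \<pi>" "\<pi> permutes {1..k}" "L \<in> tuples k"
    | (r) c where "L' = (\<lambda>l\<in>{1..k}. Const (c l) * L l)" "(\<Prod>l\<in>{1..k}. c l) = 1"
        "\<forall>l\<in>{1..k}. c l \<noteq> 0" "L \<in> tuples k"
    by (auto simp: permute_moves_def rescale_moves_def)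
  then show "(L', L) \<in> permute_moves k \<union> rescale_moves k"
  proof cases
    case p
    have L': "L' \<in> tuples k"
      unfolding p(1) tuples_def
    proof (rule PiE_I)
      fix l assume "l \<in> {1..k}"
      then have "\<pi> l \<in> {1..k}" by (simp only: permutes_in_image[OF p(2)])
      then show "(L \<circ> \<pi>) l \<in> V 1 - {0}"
        using p(3) by (auto simp only: tuples_def o_apply dest: PiE_mem)
    next
      fix l assume "l \<notin> {1..k}"
      then show "(L \<circ> \<pi>) l = undefined"
        using PiE_arb[OF p(3)[unfolded tuples_def]] permutes_not_in[OF p(2)]
        by (metis o_apply)
    qed
    have "L = L' \<circ> inv \<pi>"
      by (simp only: p(1) o_assoc[symmetric] permutes_inv_o(1)[OF p(2)] o_id)
    then have "(L', L) \<in> permute_moves k"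
      unfolding permute_moves_def using L' permutes_inv[OF p(2)] by blast
    then show ?thesis by (rule UnI1)
  next
    case r
    define c' where "c' l = inverse (c l)" for l
    have cancel: "Const (c' l) * (Const (c l) * L l) = L l" if "l \<in> {1..k}" for l
    proof -
      have "c' l * c l = 1" using r(3) that by (auto simp: c'_def)
      then show ?thesis by (metis Const_1 Const_mult mult.assoc mult_1_left)
    qed
    have V: "Const a * p \<in> V 1" if "p \<in> V 1" for a p
    proof -
      have "Const a * p = Poly_Mapping.map ((*) a) p"
        by (simp add: Const_def mult_map_scale_conv_mult)
      then have "Poly_Mapping.keys (Const a * p) \<subseteq> Poly_Mapping.keys p"
        by (auto simp: in_keys_iff Poly_Mapping.map.rep_eq when_def)
      then show ?thesis using that by (auto simp: V_def)
    qed
    have L: "L l \<in> V 1 \<and> L l \<noteq> 0" if "l \<in> {1..k}" for l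
      using r(4) that by (auto simp: tuples_def)
    have "Const (c l) * L l \<noteq> 0" if "l \<in> {1..k}" for l
      using cancel[OF that] L[OF that] by (metis mult_zero_right)
    then have "L' \<in> tuples k"
      unfolding r(1) tuples_def restrict_PiE_iff using L V by blast
    moreover have "L = (\<lambda>l\<in>{1..k}. Const (c' l) * L' l)"
    proof
      fix l
      show "L l = (\<lambda>l\<in>{1..k}. Const (c' l) * L' l) l"
      proof (cases "l \<in> {1..k}")
        case True
        then show ?thesis using cancel[OF True] by (simp only: r(1) restrict_apply' if_True)
      next
        case False
        then show ?thesis
          using PiE_arb[OF r(4)[unfolded tuples_def]] by (metis restrict_def)
      qed
    qed
    moreover have "(\<Prod>l\<in>{1..k}. c' l) = 1"
      using r(2) prod_inversef[of c "{1..k}"] by (simp add: c'_def o_def)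
    moreover have "\<forall>l\<in>{1..k}. c' l \<noteq> 0" using r(3) by (simp add: c'_def)
    ultimately have "(L', L) \<in> rescale_moves k"
      unfolding rescale_moves_def mem_Collect_eq prod.inject
      by (intro exI[of _ L'] exI[of _ c'] conjI refl) assumption+
    then show ?thesis by (rule UnI2)
  qed
qed

lemma equiv_multipole_rel: "equiv (tuples k) (multipole_rel k)"
proof (rule equivI)
  show "multipole_rel k \<subseteq> tuples k \<times> tuples k"
    by (simp add: multipole_rel_def)
  show "refl_on (tuples k) (multipole_rel k)"
    by (simp add: multipole_rel_def refl_on_def)
  show "sym (multipole_rel k)"
    unfolding multipole_rel_def using sym_rtrancl[OF sym_moves[of k]]
    by (simp add: sym_def)
  show "trans (multipole_rel k)"
    unfolding multipole_rel_def
    by (rule transI) (simp, metis rtrancl_trans)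
qed

lemma multipole_rel_prod:
  assumes "(L, L') \<in> multipole_rel k"
  shows "(\<Prod>l\<in>{1..k}. L' l) = (\<Prod>l\<in>{1..k}. L l)"
proof -
  have "(L, L') \<in> (permute_moves k \<union> rescale_moves k)\<^sup>*"
    using assms by (simp add: multipole_rel_def)
  then show ?thesis by (induction rule: rtrancl_induct) (use moves_prod in auto)
qed

lemma Theta_class:
  assumes "w \<in> multipoles k" "L \<in> w"
  shows "Theta k w = (\<Prod>l\<in>{1..k}. L l)"
proof -
  have "(L, L') \<in> multipole_rel k" if "L' \<in> w" for L'
    using quotient_eq_iff[OF equiv_multipole_rel, of w k w L L'] assms that
    by (simp only: multipoles_def simp_thms)
  then have "(\<lambda>L. \<Prod>l\<in>{1..k}. L l) ` w = {\<Prod>l\<in>{1..k}. L l}"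
    using multipole_rel_prod assms(2) by fast
  then show ?thesis by (simp add: Theta_def)
qed

end

theory Submission
  imports Defs
    "HOL-Analysis.Cartesian_Space"
    "HOL-Computational_Algebra.Fundamental_Theorem_Algebra"
    "HOL-Library.Multiset"
begin

text \<open>
  An irreducible quadratic form has rank three, so over \<open>\<complex>\<close> it is \<open>\<gamma> (y\<^sup>2 - x z)\<close> in a suitable
  basis \<open>x, y, z\<close> of the linear forms (\<open>irreducible_imp_conic\<close>): complete a square and split
  the remaining binary form.  The conic \<open>Q = 0\<close> is then the rational curve with coordinates
  \<open>(1, t, t\<^sup>2)\<close>.  Restriction to it identifies forms of degree \<open>k\<close> modulo \<open>Q\<close> with polynomials in
  \<open>t\<close> of degree at most \<open>2 k\<close>, that is, with binary forms of degree \<open>2 k\<close>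
  (\<open>kernel_pullback\<close>); linear forms correspond to all polynomials of degree at most \<open>2\<close>.  To write a
  form of degree \<open>k\<close> as a product of linear forms modulo \<open>Q\<close> is therefore to group \<open>2 k\<close> roots
  into \<open>k\<close> pairs.  This is always possible (\<open>congruent_to_product\<close>) and, up to order and scaling,
  possible in at most \<open>(2 k - 1)!!\<close> ways (\<open>card_factorizations\<close>, \<open>card_fibre\<close>).

  Existence follows by descending degree: once the leading form has been replaced by a product, the error
  \<open>Q g\<close> equals \<open>g\<close> on the surface and has lower degree (\<open>representation_exists\<close>).  For
  the bound, the surface is asymptotic to the cone \<open>Q = 0\<close>, so the function on the surface
  determines the leading form modulo \<open>Q\<close> (\<open>leading_form_dvd\<close>).  This leaves at most \<open>(2 d - 1)!!\<close>
  choices for the leading multipole, and each choice determines the function left for the lower degrees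
  (\<open>card_seqs_representing\<close>).
\<close>

section \<open>Polynomials in three variables\<close>

lemma poly3_eq_sum_monomials:
  fixes p :: poly3
  shows "p = (\<Sum>m\<in>Poly_Mapping.keys p. Poly_Mapping.single m (Poly_Mapping.lookup p m))"
  by (rule poly_mapping_eqI)
    (simp add: lookup_sum lookup_single when_def in_keys_iff)

lemma poly3_times_eq_sum_monomials:
  fixes p q :: poly3
  shows "p * q = (\<Sum>m\<in>Poly_Mapping.keys p. \<Sum>n\<in>Poly_Mapping.keys q.
    Poly_Mapping.single (m + n) (Poly_Mapping.lookup p m * Poly_Mapping.lookup q n))"
proof -
  have "p * q = (\<Sum>m\<in>Poly_Mapping.keys p. Poly_Mapping.single m (Poly_Mapping.lookup p m)) *
      (\<Sum>n\<in>Poly_Mapping.keys q. Poly_Mapping.single n (Poly_Mapping.lookup q n))"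
    using poly3_eq_sum_monomials[of p] poly3_eq_sum_monomials[of q] by metis
  then show ?thesis by (simp add: sum_product mult_single)
qed

lemma mono_degree_add: "mono_degree (m + n) = mono_degree m + mono_degree n"
  by (simp add: mono_degree_def lookup_add sum.distrib)

lemma mono_degree_0: "mono_degree 0 = 0"
  by (simp add: mono_degree_def)

lemma mono_degree_eq_0_iff: "mono_degree m = 0 \<longleftrightarrow> m = 0"
  by (auto simp: mono_degree_def intro: poly_mapping_eqI)

lemma mono_degree_single: "mono_degree (Poly_Mapping.single i n) = n"
  by (simp add: mono_degree_def lookup_single when_def)

lemma mono_degree_SucE:
  assumes "mono_degree m = Suc k"
  obtains i m' where "m = Poly_Mapping.single i 1 + m'" "mono_degree m' = k"
proof -
  from assms obtain i where i: "Poly_Mapping.lookup m i > 0"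
    unfolding mono_degree_def by (metis gr0I sum.neutral Zero_not_Suc)
  define m' where "m' = m - Poly_Mapping.single i 1"
  have m: "m = Poly_Mapping.single i 1 + m'"
    using i by (intro poly_mapping_eqI) (auto simp: m'_def lookup_add lookup_minus lookup_single when_def)
  moreover have "mono_degree m' = k"
    using assms mono_degree_add[of "Poly_Mapping.single i 1" m']
    by (simp only: m[symmetric] mono_degree_single)
  ultimately show ?thesis by (rule that)
qed

subsection \<open>Evaluation is a ring homomorphism\<close>

lemma eval_superset:
  assumes "finite S" "Poly_Mapping.keys p \<subseteq> S"
  shows "eval p v = (\<Sum>m\<in>S. Poly_Mapping.lookup p m * (\<Prod>i\<in>UNIV. (v $ i) ^ Poly_Mapping.lookup m i))"
  unfolding eval_def by (rule sum.mono_neutral_left) (use assms in \<open>auto simp: in_keys_iff\<close>)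

lemma eval_single:
  "eval (Poly_Mapping.single m c) v = c * (\<Prod>i\<in>UNIV. (v $ i) ^ Poly_Mapping.lookup m i)"
  by (subst eval_superset[of "{m}"]) auto

lemma eval_0 [simp]: "eval 0 v = 0"
  by (simp add: eval_def)

lemma eval_add [simp]: "eval (p + q) v = eval p v + eval q v"
  using Poly_Mapping.keys_add[of p q]
  by (simp add: eval_superset[of "Poly_Mapping.keys p \<union> Poly_Mapping.keys q"] lookup_add
      sum.distrib algebra_simps)

lemma eval_Const [simp]: "eval (Const c) v = c"
  by (simp add: Const_def eval_single)

lemma eval_sum [simp]: "eval (sum f A) v = (\<Sum>x\<in>A. eval (f x) v)"
  by (induction A rule: infinite_finite_induct) simp_all

lemma eval_mult [simp]: "eval (p * q) v = eval p v * eval q v"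
proof -
  have "eval (p * q) v = (\<Sum>m\<in>Poly_Mapping.keys p. \<Sum>n\<in>Poly_Mapping.keys q.
      (Poly_Mapping.lookup p m * (\<Prod>i\<in>UNIV. (v $ i) ^ Poly_Mapping.lookup m i)) *
      (Poly_Mapping.lookup q n * (\<Prod>i\<in>UNIV. (v $ i) ^ Poly_Mapping.lookup n i)))"
    by (simp add: poly3_times_eq_sum_monomials eval_single lookup_add power_add prod.distrib
        algebra_simps)
  then show ?thesis by (simp add: eval_def sum_product)
qed

lemma eval_uminus [simp]: "eval (- p) v = - eval p v"
  using eval_add[of p "- p" v] by (simp add: eq_neg_iff_add_eq_0 add.commute)

lemma eval_diff [simp]: "eval (p - q) v = eval p v - eval q v"
  using eval_add[of p "- q" v] by simp

lemma eval_1 [simp]: "eval 1 v = 1"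
  using eval_Const[of 1 v] by (simp add: Const_1)

lemma eval_prod [simp]: "eval (prod f A) v = (\<Prod>x\<in>A. eval (f x) v)"
  by (induction A rule: infinite_finite_induct) simp_all

lemma Const_0 [simp]: "Const 0 = 0"
  by (simp add: Const_def)

lemma Const_numeral [simp]: "Const (numeral n) = numeral n"
  by (simp add: Const_def)

lemma Const_add: "Const (a + b) = Const a + Const b"
  by (simp add: Const_def single_add)

lemma Const_uminus: "Const (- a) = - Const a"
  by (simp add: Const_def single_uminus)

lemma Const_diff: "Const (a - b) = Const a - Const b"
  by (simp add: Const_def single_diff)

lemma Const_inverse_mult: "a \<noteq> 0 \<Longrightarrow> Const (inverse a) * (Const a * p) = p"
  by (simp add: Const_1 flip: mult.assoc Const_mult)

subsection \<open>Homogeneous polynomials\<close>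

lemma V_0 [simp]: "0 \<in> V k"
  by (simp add: V_def)

lemma V_add: "p \<in> V k \<Longrightarrow> q \<in> V k \<Longrightarrow> p + q \<in> V k"
  using Poly_Mapping.keys_add[of p q] by (auto simp: V_def)

lemma V_sum: "(\<And>x. x \<in> A \<Longrightarrow> f x \<in> V k) \<Longrightarrow> sum f A \<in> V k"
  by (induction A rule: infinite_finite_induct) (auto intro: V_add)

lemma V_mult: "p \<in> V j \<Longrightarrow> q \<in> V k \<Longrightarrow> p * q \<in> V (j + k)"
  using Poly_Mapping.keys_mult[of p q] by (fastforce simp: V_def mono_degree_add)

lemma V_Const: "Const c \<in> V 0"
  by (simp add: V_def Const_def mono_degree_0)

lemma V_Const_mult: "p \<in> V k \<Longrightarrow> Const c * p \<in> V k"
  using V_mult[OF V_Const, of p k c] by simp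

lemma V_uminus: "p \<in> V k \<Longrightarrow> - p \<in> V k"
  using V_Const_mult[of p k "- 1"] by (simp add: Const_uminus Const_1)

lemma V_diff: "p \<in> V k \<Longrightarrow> q \<in> V k \<Longrightarrow> p - q \<in> V k"
  using V_add[OF _ V_uminus, of p k q] by simp

lemma V_power: "p \<in> V 1 \<Longrightarrow> p ^ n \<in> V n"
proof (induction n)
  case 0
  then show ?case using V_Const[of 1] by (simp add: Const_1)
next
  case (Suc n)
  then show ?case using V_mult[of p 1 "p ^ n" n] by simp
qed

lemma V_prod: "finite A \<Longrightarrow> (\<And>x. x \<in> A \<Longrightarrow> f x \<in> V 1) \<Longrightarrow> prod f A \<in> V (card A)"
proof (induction A rule: finite_induct)
  case empty
  then show ?case using V_Const[of 1] by (simp add: Const_1)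
next
  case (insert x A)
  then show ?case using V_mult[of "f x" 1 "prod f A" "card A"] by simp
qed

lemma V_0E:
  assumes "p \<in> V 0"
  obtains c where "p = Const c"
proof
  have "m \<notin> Poly_Mapping.keys p" if "m \<noteq> 0" for m
    using assms that by (auto simp: V_def mono_degree_eq_0_iff)
  then show "p = Const (Poly_Mapping.lookup p 0)"
    by (intro poly_mapping_eqI) (auto simp: Const_def lookup_single when_def in_keys_iff)
qed

definition Var :: "3 \<Rightarrow> poly3" where
  "Var i = Poly_Mapping.single (Poly_Mapping.single i 1) 1"

lemma Var_V: "Var i \<in> V 1"
  by (simp add: V_def Var_def mono_degree_single del: One_nat_def)

lemma eval_Var [simp]: "eval (Var i) v = v $ i"
  by (simp add: Var_def eval_single lookup_single when_def if_distrib prod.If_cases cong: if_cong)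

text \<open>Splitting a variable off every monomial is the induction step for statements about forms, and it
  exhibits the coefficients in degrees one and two.\<close>

lemma V_SucE:
  assumes "p \<in> V (Suc k)"
  obtains h where "\<And>i. h i \<in> V k" "p = (\<Sum>i\<in>UNIV. Var i * h i)"
proof -
  have "\<exists>i m'. m = Poly_Mapping.single i 1 + m' \<and> mono_degree m' = k"
    if "m \<in> Poly_Mapping.keys p" for m
  proof -
    have "mono_degree m = Suc k" using assms that by (simp add: V_def)
    then show ?thesis by (rule mono_degree_SucE) blast
  qed
  then obtain I M where IM: "\<And>m. m \<in> Poly_Mapping.keys p \<Longrightarrow>
      m = Poly_Mapping.single (I m) 1 + M m \<and> mono_degree (M m) = k"
    by metis
  define t where "t m = Poly_Mapping.single (M m) (Poly_Mapping.lookup p m)" for m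
  define h where "h i = (\<Sum>m\<in>{m \<in> Poly_Mapping.keys p. I m = i}. t m)" for i
  have "h i \<in> V k" for i
    unfolding h_def by (rule V_sum) (use IM in \<open>auto simp: t_def V_def split: if_splits\<close>)
  moreover have "p = (\<Sum>i\<in>UNIV. Var i * h i)"
  proof -
    have "p = (\<Sum>m\<in>Poly_Mapping.keys p. Var (I m) * t m)"
      by (subst poly3_eq_sum_monomials, rule sum.cong[OF refl])
        (use IM in \<open>simp add: Var_def t_def mult_single\<close>)
    also have "\<dots> = (\<Sum>i\<in>UNIV. \<Sum>m\<in>{m \<in> Poly_Mapping.keys p. I m = i}. Var (I m) * t m)"
      by (rule sum.group[symmetric]) auto
    also have "\<dots> = (\<Sum>i\<in>UNIV. Var i * h i)"
      by (intro sum.cong refl) (auto simp: h_def sum_distrib_left)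
    finally show ?thesis .
  qed
  ultimately show ?thesis by (rule that)
qed

lemma V_1E:
  assumes "p \<in> V 1"
  obtains a where "p = (\<Sum>i\<in>UNIV. Const (a i) * Var i)"
proof -
  obtain h where h: "\<And>i. h i \<in> V 0" "p = (\<Sum>i\<in>UNIV. Var i * h i)"
    using V_SucE[of p 0] assms by auto
  have "\<forall>i. \<exists>c. h i = Const c" using V_0E h(1) by blast
  then obtain a where "\<And>i. h i = Const (a i)" by metis
  with h(2) show ?thesis by (intro that[of a]) (simp add: mult.commute)
qed

lemma split_leading_form:
  fixes P :: poly3
  assumes "\<And>m. m \<in> Poly_Mapping.keys P \<Longrightarrow> mono_degree m \<le> Suc d"
  obtains T R where "P = T + R" "T \<in> V (Suc d)"
    "\<And>m. m \<in> Poly_Mapping.keys R \<Longrightarrow> mono_degree m \<le> d"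
proof -
  define part where "part S = (\<Sum>m\<in>S. Poly_Mapping.single m (Poly_Mapping.lookup P m))" for S
  define A where "A = {m \<in> Poly_Mapping.keys P. mono_degree m = Suc d}"
  define B where "B = {m \<in> Poly_Mapping.keys P. mono_degree m \<noteq> Suc d}"
  have keys: "Poly_Mapping.keys (part S) \<subseteq> S" if "finite S" for S
    using that by (auto simp: part_def in_keys_iff lookup_sum lookup_single when_def
        split: if_splits)
  have fin: "finite A" "finite B" by (auto simp: A_def B_def)
  have "Poly_Mapping.keys P = A \<union> B" "A \<inter> B = {}" by (auto simp: A_def B_def)
  then have "P = part A + part B"
    using poly3_eq_sum_monomials[of P] fin by (simp add: part_def sum.union_disjoint)
  moreover have "part A \<in> V (Suc d)"
    using keys[OF fin(1)] by (auto simp: V_def A_def)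
  moreover have "mono_degree m \<le> d" if "m \<in> Poly_Mapping.keys (part B)" for m
    using that keys[OF fin(2)] assms[of m] by (auto simp: B_def)
  ultimately show ?thesis by (rule that)
qed

subsection \<open>Substituting univariate polynomials\<close>

definition psubst :: "(3 \<Rightarrow> complex poly) \<Rightarrow> poly3 \<Rightarrow> complex poly" where
  "psubst g p = (\<Sum>m\<in>Poly_Mapping.keys p.
     smult (Poly_Mapping.lookup p m) (\<Prod>i\<in>UNIV. g i ^ Poly_Mapping.lookup m i))"

lemma poly_psubst: "poly (psubst g p) t = eval p (\<chi> i. poly (g i) t)"
  by (simp add: psubst_def eval_def poly_sum poly_prod)

text \<open>A univariate polynomial is determined by its values, so the homomorphism laws are those of
  evaluation.\<close>

lemma psubst_eqI: "(\<And>t. poly (psubst g p) t = poly r t) \<Longrightarrow> psubst g p = r"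
  using poly_eq_poly_eq_iff[of "psubst g p" r] by (simp add: fun_eq_iff)

lemma psubst_0 [simp]: "psubst g 0 = 0"
  by (rule psubst_eqI) (simp add: poly_psubst)

lemma psubst_add [simp]: "psubst g (p + q) = psubst g p + psubst g q"
  by (rule psubst_eqI) (simp add: poly_psubst)

lemma psubst_diff [simp]: "psubst g (p - q) = psubst g p - psubst g q"
  by (rule psubst_eqI) (simp add: poly_psubst)

lemma psubst_mult [simp]: "psubst g (p * q) = psubst g p * psubst g q"
  by (rule psubst_eqI) (simp add: poly_psubst)

lemma psubst_Const [simp]: "psubst g (Const c) = [:c:]"
  by (rule psubst_eqI) (simp add: poly_psubst)

lemma psubst_prod [simp]: "psubst g (prod f A) = (\<Prod>x\<in>A. psubst g (f x))"
  by (rule psubst_eqI) (simp add: poly_psubst poly_prod)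

lemma psubst_sum [simp]: "psubst g (sum f A) = (\<Sum>x\<in>A. psubst g (f x))"
  by (rule psubst_eqI) (simp add: poly_psubst poly_sum)

lemma eval_scale_homogeneous:
  assumes "p \<in> V k"
  shows "eval p (\<chi> i. s * v $ i) = s ^ k * eval p v"
proof -
  have "(\<Prod>i\<in>UNIV. (s * v $ i) ^ Poly_Mapping.lookup m i)
      = s ^ k * (\<Prod>i\<in>UNIV. v $ i ^ Poly_Mapping.lookup m i)"
    if "m \<in> Poly_Mapping.keys p" for m
  proof -
    have "mono_degree m = k" using assms that by (auto simp: V_def)
    then show ?thesis by (simp add: power_mult_distrib prod.distrib mono_degree_def flip: power_sum)
  qed
  then show ?thesis by (simp add: eval_def sum_distrib_left algebra_simps)
qed

lemma eval_linear_combination: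
  assumes "L \<in> V 1"
  shows "eval L (\<chi> i. a * u $ i + b * v $ i) = a * eval L u + b * eval L v"
proof -
  obtain c where L: "L = (\<Sum>i\<in>UNIV. Const (c i) * Var i)" using V_1E[OF assms] .
  show ?thesis by (simp add: L algebra_simps sum.distrib sum_distrib_left)
qed

section \<open>The conic as a rational curve\<close>

text \<open>
  The possible cofactors of a quadratic form in a form of degree \<open>k\<close>.  Adding \<open>2\<close> on the left,
  instead of subtracting it from \<open>k\<close>, leaves only the zero polynomial when \<open>k < 2\<close>.
\<close>

definition V_minus2 :: "nat \<Rightarrow> poly3 set" where
  "V_minus2 k = {h. \<forall>m\<in>Poly_Mapping.keys h. mono_degree m + 2 = k}"

lemma V_minus2_Suc_Suc: "V_minus2 (Suc (Suc k)) = V k"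
  by (simp add: V_minus2_def V_def)

lemma V_minus2_0 [simp]: "0 \<in> V_minus2 k"
  by (simp add: V_minus2_def)

lemma V_minus2_add: "g \<in> V_minus2 k \<Longrightarrow> h \<in> V_minus2 k \<Longrightarrow> g + h \<in> V_minus2 k"
  using Poly_Mapping.keys_add[of g h] by (auto simp: V_minus2_def)

lemma V_minus2_mult: "g \<in> V j \<Longrightarrow> h \<in> V_minus2 k \<Longrightarrow> g * h \<in> V_minus2 (j + k)"
  using Poly_Mapping.keys_mult[of g h] by (fastforce simp: V_def V_minus2_def mono_degree_add)

text \<open>
  Here \<open>x, y, z\<close> is a basis of the linear forms in which \<open>Q\<close> is \<open>\<gamma> (y\<^sup>2 - x z)\<close>, and
  \<open>e1, e2, e3\<close> is the dual basis of \<open>\<complex>\<^sup>3\<close>.  The curve \<open>e1 + t e2 + t\<^sup>2 e3\<close> has coordinates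
  \<open>(1, t, t\<^sup>2)\<close>, so it parametrizes the projective conic \<open>Q = 0\<close> up to the one point \<open>e3\<close>.
\<close>

locale conic =
  fixes Q x y z :: poly3 and \<gamma> :: complex and e1 e2 e3 :: "complex ^ 3"
  assumes forms: "x \<in> V 1" "y \<in> V 1" "z \<in> V 1"
    and \<gamma>: "\<gamma> \<noteq> 0"
    and Q: "Q = Const \<gamma> * (y * y - x * z)"
    and coordinates: "L \<in> V 1 \<Longrightarrow>
      L = Const (eval L e1) * x + Const (eval L e2) * y + Const (eval L e3) * z"
    and dual: "eval x e1 = 1" "eval x e2 = 0" "eval x e3 = 0"
      "eval y e1 = 0" "eval y e2 = 1" "eval y e3 = 0"
      "eval z e1 = 0" "eval z e2 = 0" "eval z e3 = 1"
begin

text \<open>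
  Restriction to the parametrized conic.  A form of degree \<open>k\<close> becomes a polynomial in \<open>t\<close> of degree at
  most \<open>2 k\<close>; missing degree stands for zeros at the omitted point \<open>e3\<close>.
\<close>

definition pullback :: "poly3 \<Rightarrow> complex poly" where
  "pullback = psubst (\<lambda>i. [:e1 $ i, e2 $ i, e3 $ i:])"

lemma pullback_hom [simp]:
  "pullback 0 = 0"
  "pullback (f + g) = pullback f + pullback g"
  "pullback (f - g) = pullback f - pullback g"
  "pullback (f * g) = pullback f * pullback g"
  "pullback (Const c) = [:c:]"
  "pullback (prod F A) = (\<Prod>a\<in>A. pullback (F a))"
  "pullback (sum F A) = (\<Sum>a\<in>A. pullback (F a))"
  by (simp_all add: pullback_def)

lemma poly_pullback:
  "poly (pullback f) t = eval f (\<chi> i. e1 $ i + t * (e2 $ i + t * e3 $ i))"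
  by (simp add: pullback_def poly_psubst)

lemma pullback_linear:
  assumes "L \<in> V 1"
  shows "pullback L = [:eval L e1, eval L e2, eval L e3:]"
proof -
  obtain a where L: "L = (\<Sum>i\<in>UNIV. Const (a i) * Var i)" using V_1E[OF assms] .
  show ?thesis unfolding pullback_def
    by (rule psubst_eqI, unfold poly_psubst L)
      (simp add: algebra_simps sum.distrib sum_distrib_left)
qed

lemma pullback_x: "pullback x = 1"
  and pullback_y: "pullback y = [:0, 1:]"
  and pullback_z: "pullback z = [:0, 0, 1:]"
  by (simp_all add: pullback_linear[OF forms(1)] pullback_linear[OF forms(2)]
      pullback_linear[OF forms(3)] dual one_pCons)

lemma pullback_Q: "pullback Q = 0"
  by (simp add: Q pullback_x pullback_y pullback_z)

lemma pullback_linear_inj: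
  assumes "L \<in> V 1" "M \<in> V 1" "pullback L = pullback M"
  shows "L = M"
proof -
  have "eval L e1 = eval M e1" "eval L e2 = eval M e2" "eval L e3 = eval M e3"
    using assms(3) by (simp_all add: pullback_linear[OF assms(1)] pullback_linear[OF assms(2)])
  then show ?thesis using coordinates[OF assms(1)] coordinates[OF assms(2)] by metis
qed

lemma pullback_linear_surj:
  assumes "degree q \<le> 2"
  obtains L where "L \<in> V 1" "pullback L = q"
proof -
  define L where "L = Const (coeff q 0) * x + Const (coeff q 1) * y + Const (coeff q 2) * z"
  have "L \<in> V 1" unfolding L_def by (intro V_add V_Const_mult forms)
  moreover have "pullback L = q"
  proof (rule poly_eqI)
    fix n
    have "coeff q (Suc (Suc (Suc m))) = 0" for m using assms by (simp add: coeff_eq_0)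
    then show "coeff (pullback L) n = coeff q n"
      by (simp add: L_def pullback_x pullback_y pullback_z coeff_pCons numeral_2_eq_2 split: nat.split)
  qed
  ultimately show ?thesis by (rule that)
qed

lemma pullback_linear_nonzero: "L \<in> V 1 \<Longrightarrow> L \<noteq> 0 \<Longrightarrow> pullback L \<noteq> 0"
  using pullback_linear_inj[of L 0] by auto

text \<open>
  Modulo \<open>Q\<close>, the relation \<open>y\<^sup>2 = x z\<close> rewrites every monomial in \<open>x, y, z\<close> to one with at most one
  factor \<open>y\<close>.  In degree \<open>k\<close> these are the following monomials with \<open>j \<le> 2 k\<close>, and the \<open>j\<close>-th
  restricts to \<open>t\<^sup>j\<close>.
\<close>

definition basis :: "nat \<Rightarrow> nat \<Rightarrow> poly3" where
  "basis k j = x ^ (k - (j + 1) div 2) * y ^ (j mod 2) * z ^ (j div 2)"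

text \<open>
  The resulting section of the restriction map from forms of degree \<open>k\<close> to polynomials of degree at
  most \<open>2 k\<close>.  Multiplication by \<open>x, y, z\<close> corresponds, exactly or modulo \<open>Q\<close>, to
  multiplication by \<open>1, t, t\<^sup>2\<close>, see \<open>x_times_lift\<close>, \<open>y_times_lift\<close> and \<open>z_times_lift\<close>.
\<close>

definition lift :: "nat \<Rightarrow> complex poly \<Rightarrow> poly3" where
  "lift k p = (\<Sum>j\<le>2 * k. Const (coeff p j) * basis k j)"

lemma lift_add: "lift k (p + q) = lift k p + lift k q"
  by (simp add: lift_def Const_add distrib_right sum.distrib)

lemma lift_smult: "lift k (smult c p) = Const c * lift k p"
  by (simp add: lift_def Const_mult sum_distrib_left mult.assoc)

lemma lift_0: "lift k 0 = 0"
  by (simp add: lift_def)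

text \<open>
  Congruence modulo \<open>Q\<close> with a homogeneous cofactor, whose degree is needed when \<open>Q\<close> is replaced
  by \<open>1\<close> on the surface.
\<close>

definition cong :: "nat \<Rightarrow> poly3 \<Rightarrow> poly3 \<Rightarrow> bool" where
  "cong k f g \<longleftrightarrow> (\<exists>h\<in>V_minus2 k. f - g = Q * h)"

lemma congI: "h \<in> V_minus2 k \<Longrightarrow> f - g = Q * h \<Longrightarrow> cong k f g"
  unfolding cong_def by blast

lemma cong_refl: "cong k f f"
  by (rule congI[of 0]) simp_all

lemma cong_trans: "cong k f g \<Longrightarrow> cong k g h \<Longrightarrow> cong k f h"
proof -
  assume "cong k f g" "cong k g h"
  then obtain r s where "r \<in> V_minus2 k" "f - g = Q * r" "s \<in> V_minus2 k" "g - h = Q * s"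
    unfolding cong_def by blast
  then show ?thesis
    by (intro congI[of "r + s"] V_minus2_add) (simp_all add: algebra_simps)
qed

lemma cong_add:
  assumes "cong k f g" "cong k f' g'"
  shows "cong k (f + f') (g + g')"
proof -
  obtain h h' where "h \<in> V_minus2 k" "f - g = Q * h" "h' \<in> V_minus2 k" "f' - g' = Q * h'"
    using assms unfolding cong_def by blast
  then show ?thesis
    by (intro congI[of "h + h'"] V_minus2_add) (simp_all add: algebra_simps)
qed

lemma cong_mult:
  assumes "cong k f g" "p \<in> V j"
  shows "cong (j + k) (p * f) (p * g)"
proof -
  obtain h where "h \<in> V_minus2 k" "f - g = Q * h"
    using assms unfolding cong_def by blast
  moreover from this have "p * f - p * g = Q * (p * h)"
    by (metis mult.left_commute right_diff_distrib)
  ultimately show ?thesis using assms(2)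
    by (intro congI[of "p * h"] V_minus2_mult)
qed

lemma cong_sum: "(\<And>i. i \<in> A \<Longrightarrow> cong k (F i) (G i)) \<Longrightarrow> cong k (sum F A) (sum G A)"
  by (induction A rule: infinite_finite_induct) (auto intro: cong_add cong_refl)

lemma times_lift: "u * lift k p = (\<Sum>j\<le>2 * k. Const (coeff p j) * (u * basis k j))"
  unfolding lift_def sum_distrib_left by (intro sum.cong refl mult.left_commute)

lemma lift_pCons_0:
  "lift (Suc k) (pCons 0 p) = (\<Sum>j\<le>Suc (2 * k). Const (coeff p j) * basis (Suc k) (Suc j))"
proof -
  have "lift (Suc k) (pCons 0 p)
      = (\<Sum>j\<le>Suc (Suc (2 * k)). Const (coeff (pCons 0 p) j) * basis (Suc k) j)"
    by (simp add: lift_def)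
  then show ?thesis by (subst (asm) sum.atMost_Suc_shift) simp
qed

lemma x_times_lift:
  assumes "degree p \<le> 2 * k"
  shows "x * lift k p = lift (Suc k) p"
proof -
  have "x * basis k j = basis (Suc k) j" if "j \<le> 2 * k" for j
  proof -
    have "Suc k - (j + 1) div 2 = Suc (k - (j + 1) div 2)" using that by (intro Suc_diff_le) linarith
    then show ?thesis by (simp add: basis_def mult.assoc)
  qed
  then have "x * lift k p = (\<Sum>j\<le>2 * k. Const (coeff p j) * basis (Suc k) j)"
    unfolding times_lift by (intro sum.cong) simp_all
  moreover have "coeff p (Suc (2 * k)) = 0" "coeff p (Suc (Suc (2 * k))) = 0"
    using assms by (simp_all add: coeff_eq_0)
  ultimately show ?thesis by (simp add: lift_def)
qed

lemma z_times_lift: "z * lift k p = lift (Suc k) (pCons 0 (pCons 0 p))"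
proof -
  have "z * basis k j = basis (Suc k) (Suc (Suc j))" for j
    by (simp add: basis_def ac_simps)
  then show ?thesis
    unfolding times_lift lift_pCons_0 by (subst sum.atMost_Suc_shift) simp
qed

lemma basis_even: "basis k (2 * i) = x ^ (k - i) * z ^ i"
  and basis_odd: "basis k (Suc (2 * i)) = x ^ (k - Suc i) * y * z ^ i"
  and basis_Suc_odd: "basis k (Suc (Suc (2 * i))) = x ^ (k - Suc i) * z ^ Suc i"
  by (simp_all add: basis_def)

text \<open>
  For odd \<open>j\<close> the product contains \<open>y\<^sup>2\<close>, and this is the one place where the relation
  \<open>y\<^sup>2 = x z\<close> is applied.
\<close>

lemma y_times_basis:
  assumes "j \<le> 2 * k"
  shows "cong (Suc k) (y * basis k j) (basis (Suc k) (Suc j))"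
proof (cases "even j")
  case True
  then obtain i where "j = 2 * i" by (rule evenE)
  then have "y * basis k j = basis (Suc k) (Suc j)"
    by (simp add: basis_even basis_odd mult.left_commute mult.assoc)
  then show ?thesis by (simp add: cong_refl)
next
  case False
  then obtain i where j: "j = Suc (2 * i)" by (auto elim: oddE)
  have "i + 1 \<le> k" using assms j by linarith
  then obtain n where k: "k = i + 1 + n" by (auto simp: le_iff_add)
  have "y * basis k j - basis (Suc k) (Suc j) = (y * y - x * z) * (x ^ n * z ^ i)"
    unfolding j basis_odd basis_Suc_odd by (simp add: k algebra_simps)
  also have "\<dots> = Q * (Const (inverse \<gamma>) * (x ^ n * z ^ i))"
    using Const_inverse_mult[OF \<gamma>, of 1] by (simp add: Q ac_simps)
  finally show ?thesis
  proof (rule congI[rotated])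
    have "x ^ n * z ^ i \<in> V (n + i)" by (intro V_mult V_power forms)
    then show "Const (inverse \<gamma>) * (x ^ n * z ^ i) \<in> V_minus2 (Suc k)"
      by (simp add: k V_Const_mult V_minus2_Suc_Suc add.commute)
  qed
qed

lemma y_times_lift:
  assumes "degree p \<le> 2 * k"
  shows "cong (Suc k) (y * lift k p) (lift (Suc k) (pCons 0 p))"
proof -
  have "cong (Suc k) (\<Sum>j\<le>2 * k. Const (coeff p j) * (y * basis k j))
      (\<Sum>j\<le>2 * k. Const (coeff p j) * basis (Suc k) (Suc j))"
    using cong_mult[OF y_times_basis V_Const, of _ k] by (intro cong_sum) simp
  then show ?thesis
    using coeff_eq_0[of p "Suc (2 * k)"] assms by (simp add: lift_pCons_0 times_lift)
qed

text \<open>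
  Induction on the degree: a variable is a combination of \<open>x, y, z\<close>, and multiplication by each of these
  commutes with restricting and lifting back.
\<close>

lemma cong_lift_pullback:
  "f \<in> V k \<Longrightarrow> degree (pullback f) \<le> 2 * k \<and> cong k f (lift k (pullback f))"
proof (induction k arbitrary: f)
  case 0
  then obtain c where "f = Const c" by (rule V_0E)
  then show ?case by (simp add: lift_def basis_def cong_refl)
next
  case (Suc k)
  obtain h where h: "\<And>i. h i \<in> V k" and f: "f = (\<Sum>i\<in>UNIV. Var i * h i)"
    using V_SucE[OF Suc.prems] by blast
  have *: "degree (pullback (Var i * h i)) \<le> 2 * Suc k \<and>
      cong (Suc k) (Var i * h i) (lift (Suc k) (pullback (Var i * h i)))" for i
  proof -
    define p where "p = pullback (h i)"
    have deg: "degree p \<le> 2 * k" and hp: "cong k (h i) (lift k p)"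
      using Suc.IH[OF h] by (simp_all add: p_def)
    define a b c where "a = eval (Var i) e1" and "b = eval (Var i) e2" and "c = eval (Var i) e3"
    have L: "Var i = Const a * x + Const b * y + Const c * z"
      unfolding a_def b_def c_def by (rule coordinates[OF Var_V])
    have pull: "pullback (Var i * h i)
        = smult a p + (smult b (pCons 0 p) + smult c (pCons 0 (pCons 0 p)))"
      by (simp add: L p_def pullback_x pullback_y pullback_z)
    have "cong (Suc k) (Var i * h i) (Var i * lift k p)"
      using cong_mult[OF hp Var_V] by simp
    also have "Var i * lift k p
        = Const a * (x * lift k p) + (Const b * (y * lift k p) + Const c * (z * lift k p))"
      by (simp add: L distrib_right mult.assoc add.assoc)
    finally have "cong (Suc k) (Var i * h i) \<dots>" .
    moreover have "cong (Suc k) \<dots> (lift (Suc k) (pullback (Var i * h i)))"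
      unfolding pull lift_add lift_smult using cong_mult[OF y_times_lift[OF deg] V_Const[of b]]
      by (intro cong_add) (simp_all add: x_times_lift[OF deg] z_times_lift cong_refl)
    ultimately have "cong (Suc k) (Var i * h i) (lift (Suc k) (pullback (Var i * h i)))"
      by (rule cong_trans)
    moreover have "degree (pullback (Var i * h i)) \<le> 2 * Suc k"
      unfolding pull by (intro degree_add_le order_trans[OF degree_smult_le])
        (use deg in auto)
    ultimately show ?thesis by blast
  qed
  have "lift (Suc k) (sum F A) = (\<Sum>i\<in>A. lift (Suc k) (F i))" for F and A :: "3 set"
    by (induction A rule: infinite_finite_induct) (simp_all add: lift_0 lift_add)
  moreover have "degree (\<Sum>i\<in>UNIV. pullback (Var i * h i)) \<le> 2 * Suc k"
    using * by (intro degree_sum_le) auto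
  ultimately show ?case using * by (simp add: f cong_sum del: pullback_hom(4))
qed

text \<open>
  A form vanishing on the conic is congruent to the lift of the zero polynomial.
\<close>

lemma kernel_pullback:
  assumes "f \<in> V k" "pullback f = 0"
  obtains g where "g \<in> V_minus2 k" "f = Q * g"
  using cong_lift_pullback[OF assms(1)] assms(2) by (auto simp: cong_def lift_0)

lemma Q_dvd_iff:
  assumes "f \<in> V k"
  shows "Q dvd f \<longleftrightarrow> pullback f = 0"
proof
  assume "Q dvd f"
  then obtain g where "f = Q * g" by (rule dvdE)
  then show "pullback f = 0" by (simp add: pullback_Q)
next
  assume "pullback f = 0"
  with assms obtain g where "f = Q * g" by (rule kernel_pullback)
  then show "Q dvd f" by simp
qed

end

section \<open>Normal form of an irreducible quadratic form\<close>

lemma binary_quadratic_splits: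
  fixes u v w :: complex
  obtains \<alpha> \<beta> \<gamma> \<delta> where "u = \<alpha> * \<gamma>" "v = \<alpha> * \<delta> + \<beta> * \<gamma>" "w = \<beta> * \<delta>"
proof (cases "u = 0")
  case True
  then show ?thesis using that[of 0 v w 1] by simp
next
  case False
  define s where "s = csqrt (v ^ 2 - 4 * u * w)"
  have s: "s * s = v * v - 4 * u * w"
    using power2_csqrt[of "v ^ 2 - 4 * u * w"] by (simp add: s_def power2_eq_square)
  show ?thesis
  proof (rule that[of u 1 "(v + s) / (2 * u)" "(v - s) / 2"])
    have "(v - s) / 2 * ((v + s) / (2 * u)) = (v * v - s * s) / (4 * u)"
      by (simp add: algebra_simps)
    then show "w = (v - s) / 2 * ((v + s) / (2 * u))" using False by (simp add: s)
  qed (use False in \<open>simp_all add: field_simps\<close>)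
qed

lemma binary_form_splits:
  assumes "q \<in> V 1" "r \<in> V 1"
  obtains m n where "m \<in> V 1" "n \<in> V 1"
    "Const u * (q * q) + Const v * (q * r) + Const w * (r * r) = m * n"
proof -
  obtain \<alpha> \<beta> \<gamma> \<delta> where "u = \<alpha> * \<gamma>" "v = \<alpha> * \<delta> + \<beta> * \<gamma>" "w = \<beta> * \<delta>"
    by (rule binary_quadratic_splits)
  then have "Const u * (q * q) + Const v * (q * r) + Const w * (r * r)
      = (Const \<alpha> * q + Const \<beta> * r) * (Const \<gamma> * q + Const \<delta> * r)"
    by (simp add: Const_mult Const_add algebra_simps)
  then show ?thesis by (rule that[rotated 2]) (intro V_add V_Const_mult assms)+
qed

text \<open>
  A linear form vanishes at the origin, so it is not a unit.
\<close>

lemma linear_product_not_irreducible: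
  assumes "m \<in> V 1" "n \<in> V 1"
  shows "\<not> irreducible (m * n)"
proof
  have nonunit: "\<not> p dvd 1" if "p \<in> V 1" for p :: poly3
  proof
    assume "p dvd 1"
    then obtain h where h: "1 = p * h" by (rule dvdE)
    have "eval p 0 = 0" using eval_linear_combination[OF that, of 0 0 0 0] by (simp add: zero_vec_def)
    then have "eval (p * h) 0 = 0" by simp
    then show False by (simp add: h[symmetric])
  qed
  assume "irreducible (m * n)"
  then show False using nonunit assms irreducibleD by blast
qed

text \<open>
  After completing the square in \<open>p\<close>, the rest is a binary form in \<open>q\<close> and \<open>r\<close>, which splits
  into linear factors over \<open>\<complex>\<close>.
\<close>

lemma complete_square:
  assumes "p \<in> V 1" "q \<in> V 1" "r \<in> V 1" and "a \<noteq> 0"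
    and Q: "Q = Const a * (p * p) + Const b * (q * q) + Const c * (r * r)
      + Const d * (p * q) + Const e * (p * r) + Const f * (q * r)"
  obtains l m n where "l \<in> V 1" "m \<in> V 1" "n \<in> V 1"
    "Q = Const (inverse (4 * a)) * (l * l - m * n)"
proof -
  define l where "l = Const (2 * a) * p + (Const d * q + Const e * r)"
  obtain m n where mn: "m \<in> V 1" "n \<in> V 1" "Const (d * d - 4 * a * b) * (q * q)
      + Const (2 * d * e - 4 * a * f) * (q * r) + Const (e * e - 4 * a * c) * (r * r) = m * n"
    by (rule binary_form_splits[OF assms(2,3)])
  have "Const (4 * a) * Q = l * l - m * n"
    unfolding mn(3)[symmetric] Q l_def
    by (simp add: Const_mult Const_diff algebra_simps)
  then have "Q = Const (inverse (4 * a)) * (l * l - m * n)"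
    using Const_inverse_mult[of "4 * a" Q] \<open>a \<noteq> 0\<close> by simp
  moreover have "l \<in> V 1" unfolding l_def by (intro V_add V_Const_mult assms)
  ultimately show ?thesis using mn that by blast
qed

text \<open>
  Some square must have a non-zero coefficient before it can be completed.  If all three vanish, a mixed term
  \<open>d p q\<close> survives, and replacing \<open>q\<close> by \<open>p + (q - p)\<close> produces the square \<open>d p\<^sup>2\<close>.
\<close>

lemma quadratic_form_normal_form:
  assumes "Q \<in> V 2" "Q \<noteq> 0"
  obtains \<gamma> l m n where "\<gamma> \<noteq> 0" "l \<in> V 1" "m \<in> V 1" "n \<in> V 1" "Q = Const \<gamma> * (l * l - m * n)"
proof -
  note result = that
  have *: thesis
    if hyps: "p \<in> V 1" "q \<in> V 1" "r \<in> V 1" "a \<noteq> 0"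
      "Q = Const a * (p * p) + Const b * (q * q) + Const c * (r * r)
        + Const d * (p * q) + Const e * (p * r) + Const f * (q * r)" for p q r a b c d e f
  proof -
    obtain l m n where "l \<in> V 1" "m \<in> V 1" "n \<in> V 1" "Q = Const (inverse (4 * a)) * (l * l - m * n)"
      by (rule complete_square[OF hyps])
    then show thesis using \<open>a \<noteq> 0\<close> by (intro result[of "inverse (4 * a)" l m n]) simp_all
  qed
  obtain h where h: "\<And>i. h i \<in> V 1" "Q = (\<Sum>i\<in>UNIV. Var i * h i)"
    using V_SucE[of Q 1] assms(1) by (auto simp: numeral_2_eq_2)
  have "\<forall>i. \<exists>a. h i = (\<Sum>j\<in>UNIV. Const (a j) * Var j)" using V_1E[OF h(1)] by blast
  then obtain A where A: "\<And>i. h i = (\<Sum>j\<in>UNIV. Const (A i j) * Var j)" by metis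
  define p q r where "p = Var 1" and "q = Var 2" and "r = Var 3"
  have V: "p \<in> V 1" "q \<in> V 1" "r \<in> V 1" by (simp_all add: p_def q_def r_def Var_V del: One_nat_def)
  define a b c d e f where "a = A 1 1" and "b = A 2 2" and "c = A 3 3"
    and "d = A 1 2 + A 2 1" and "e = A 1 3 + A 3 1" and "f = A 2 3 + A 3 2"
  have Q: "Q = Const a * (p * p) + Const b * (q * q) + Const c * (r * r)
      + Const d * (p * q) + Const e * (p * r) + Const f * (q * r)"
    by (simp add: h(2) A sum_3 a_def b_def c_def d_def e_def f_def Const_add
        algebra_simps flip: p_def q_def r_def)
  have V': "p - q \<in> V 1" "q - p \<in> V 1" "r - q \<in> V 1" "r - p \<in> V 1"
    by (intro V_diff V)+
  have "a \<noteq> 0 \<or> b \<noteq> 0 \<or> c \<noteq> 0 \<or> d \<noteq> 0 \<or> e \<noteq> 0 \<or> f \<noteq> 0"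
    using assms(2) by (auto simp: Q)
  then consider "a \<noteq> 0" | "b \<noteq> 0" | "c \<noteq> 0" | "a = 0" "b = 0" "c = 0" "d \<noteq> 0"
    | "a = 0" "b = 0" "c = 0" "e \<noteq> 0" | "a = 0" "b = 0" "c = 0" "f \<noteq> 0"
    by blast
  then show ?thesis
  proof cases
    case 1
    show ?thesis by (rule *[OF V 1 Q])
  next
    case 2
    show ?thesis by (rule *[of q p r, OF V(2,1,3) 2]) (simp add: Q algebra_simps)
  next
    case 3
    show ?thesis by (rule *[of r p q, OF V(3,1,2) 3]) (simp add: Q algebra_simps)
  next
    case 4
    have "Q = Const d * (p * p) + Const 0 * ((q - p) * (q - p)) + Const 0 * (r * r)
        + Const d * (p * (q - p)) + Const (e + f) * (p * r) + Const f * ((q - p) * r)"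
      using 4 by (simp add: Q Const_add algebra_simps)
    then show ?thesis by (rule *[OF V(1) V'(2) V(3) 4(4)])
  next
    case 5
    have "Q = Const e * (p * p) + Const 0 * (q * q) + Const 0 * ((r - p) * (r - p))
        + Const (d + f) * (p * q) + Const e * (p * (r - p)) + Const f * (q * (r - p))"
      using 5 by (simp add: Q Const_add algebra_simps)
    then show ?thesis by (rule *[OF V(1) V(2) V'(4) 5(4)])
  next
    case 6
    have "Q = Const f * (q * q) + Const 0 * (p * p) + Const 0 * ((r - q) * (r - q))
        + Const (d + e) * (q * p) + Const f * (q * (r - q)) + Const e * (p * (r - q))"
      using 6 by (simp add: Q Const_add algebra_simps)
    then show ?thesis by (rule *[OF V(2) V(1) V'(3) 6(4)])
  qed
qed

text \<open>
  If the three linear forms were dependent, \<open>Q\<close> would be a binary form in two of them and hence a product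
  of two linear forms.
\<close>

lemma irreducible_normal_form_independent:
  assumes "irreducible Q" and Q: "Q = Const \<gamma> * (l * l - m * n)"
    and V: "l \<in> V 1" "m \<in> V 1" "n \<in> V 1"
    and dep: "Const a * l + Const b * m + Const c * n = 0"
  shows "a = 0 \<and> b = 0 \<and> c = 0"
proof -
  have binary: False if qr: "q \<in> V 1" "r \<in> V 1"
      "l * l - m * n = Const u * (q * q) + Const v * (q * r) + Const w * (r * r)" for q r u v w
  proof -
    obtain s t where "s \<in> V 1" "t \<in> V 1" "l * l - m * n = s * t"
      using binary_form_splits[OF qr(1,2), of u v w] qr(3) by metis
    then have "Q = (Const \<gamma> * s) * t" "Const \<gamma> * s \<in> V 1"
      using V_Const_mult[of s 1 \<gamma>] by (simp_all add: Q mult.assoc)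
    then show False using linear_product_not_irreducible[of "Const \<gamma> * s" t] \<open>t \<in> V 1\<close> assms(1) by simp
  qed
  have solve: "p = Const (- s / r) * q + Const (- t / r) * q'"
    if "Const r * p + Const s * q + Const t * q' = 0" "r \<noteq> 0" for r s t p q q'
  proof -
    have "p = Const (inverse r) * (Const r * p)" using Const_inverse_mult[OF that(2), of p] by simp
    also have "Const r * p = - (Const s * q + Const t * q')"
      using that(1) by (simp add: eq_neg_iff_add_eq_0 add.assoc del: minus_add_distrib)
    finally show ?thesis
      by (simp add: right_diff_distrib divide_inverse mult.commute[of _ "inverse r"] Const_mult mult.assoc
          Const_uminus)
  qed
  have "a = 0"
  proof (rule ccontr)
    assume "a \<noteq> 0"
    obtain s t where l: "l = Const s * m + Const t * n" using solve[OF dep \<open>a \<noteq> 0\<close>] by blast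
    show False
      by (rule binary[OF V(2,3), of "s * s" "s * t + s * t - 1" "t * t"])
        (simp add: l Const_mult Const_diff Const_1 Const_add algebra_simps)
  qed
  moreover have "b = 0"
  proof (rule ccontr)
    assume "b \<noteq> 0"
    moreover have "Const b * m + Const a * l + Const c * n = 0" using dep by (simp add: algebra_simps)
    ultimately obtain s t where m: "m = Const s * l + Const t * n" using solve by blast
    show False
      by (rule binary[OF V(1,3), of 1 "- s" "- t"])
        (simp add: m Const_1 Const_uminus algebra_simps)
  qed
  moreover have "c = 0"
  proof (rule ccontr)
    assume "c \<noteq> 0"
    moreover have "Const c * n + Const a * l + Const b * m = 0" using dep by (simp add: algebra_simps)
    ultimately obtain s t where n: "n = Const s * l + Const t * m" using solve by blast
    show False
      by (rule binary[OF V(1,2), of 1 "- s" "- t"])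
        (simp add: n Const_1 Const_uminus algebra_simps)
  qed
  ultimately show ?thesis by blast
qed

text \<open>
  The points of the dual basis are the columns of the inverse of the coefficient matrix.
\<close>

lemma linear_independent_dual_basis:
  assumes "x \<in> V 1" "y \<in> V 1" "z \<in> V 1"
    and indep: "\<And>a b c. Const a * x + Const b * y + Const c * z = 0 \<Longrightarrow> a = 0 \<and> b = 0 \<and> c = 0"
  obtains e1 e2 e3 where
    "eval x e1 = 1" "eval x e2 = 0" "eval x e3 = 0"
    "eval y e1 = 0" "eval y e2 = 1" "eval y e3 = 0"
    "eval z e1 = 0" "eval z e2 = 0" "eval z e3 = 1"
    "\<And>L. L \<in> V 1 \<Longrightarrow>
      L = Const (eval L e1) * x + Const (eval L e2) * y + Const (eval L e3) * z"
proof -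
  obtain a where x: "x = (\<Sum>i\<in>UNIV. Const (a i) * Var i)" by (rule V_1E[OF assms(1)])
  obtain b where y: "y = (\<Sum>i\<in>UNIV. Const (b i) * Var i)" by (rule V_1E[OF assms(2)])
  obtain c where z: "z = (\<Sum>i\<in>UNIV. Const (c i) * Var i)" by (rule V_1E[OF assms(3)])
  define A :: "complex ^ 3 ^ 3" where
    "A = (\<chi> j i. if j = 1 then a i else if j = 2 then b i else c i)"
  have A: "A $ 1 $ i = a i" "A $ 2 $ i = b i" "A $ 3 $ i = c i" for i
    by (simp_all add: A_def)
  have "\<forall>k. sum (\<lambda>j. k j *s row j A) UNIV = 0 \<longrightarrow> (\<forall>j. k j = 0)"
  proof (intro allI impI)
    fix k j
    assume "sum (\<lambda>j. k j *s row j A) UNIV = 0"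
    then have 0: "k 1 * a i + k 2 * b i + k 3 * c i = 0" for i
      by (simp add: vec_eq_iff sum_3 row_def A)
    have "Const (k 1) * x + Const (k 2) * y + Const (k 3) * z
        = (\<Sum>i\<in>UNIV. Const (k 1 * a i + k 2 * b i + k 3 * c i) * Var i)"
      by (simp add: x y z sum_distrib_left Const_add Const_mult distrib_right sum.distrib mult.assoc)
    then have "k 1 = 0 \<and> k 2 = 0 \<and> k 3 = 0" by (intro indep) (simp add: 0)
    then show "k j = 0" using exhaust_3[of j] by auto
  qed
  then obtain B where AB: "A ** B = mat 1"
    using matrix_right_invertible_independent_rows[of A] by blast
  then have BA: "B ** A = mat 1" using matrix_left_right_inverse by blast
  have AB': "(\<Sum>i\<in>UNIV. A $ j $ i * B $ i $ k) = (if j = k then 1 else 0)" for j k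
    using AB by (simp add: matrix_matrix_mult_def mat_def vec_eq_iff)
  have BA': "B $ i $ 1 * a k + B $ i $ 2 * b k + B $ i $ 3 * c k = (if i = k then 1 else 0)" for i k
    using BA by (simp add: matrix_matrix_mult_def mat_def vec_eq_iff sum_3 A)
  define e where "e j = column j B" for j
  have Var: "Var i = Const (B $ i $ 1) * x + Const (B $ i $ 2) * y + Const (B $ i $ 3) * z" for i
  proof -
    have "Const (B $ i $ 1) * x + Const (B $ i $ 2) * y + Const (B $ i $ 3) * z
        = (\<Sum>k\<in>UNIV. Const (B $ i $ 1 * a k + B $ i $ 2 * b k + B $ i $ 3 * c k) * Var k)"
      by (simp add: x y z sum_distrib_left Const_add Const_mult distrib_right sum.distrib mult.assoc)
    also have "\<dots> = (\<Sum>k\<in>UNIV. if i = k then Var k else 0)"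
      by (intro sum.cong refl) (simp add: BA' Const_1)
    finally show ?thesis by simp
  qed
  show ?thesis
  proof (rule that[of "e 1" "e 2" "e 3"])
    fix L assume "L \<in> V 1"
    then obtain l where L: "L = (\<Sum>i\<in>UNIV. Const (l i) * Var i)" by (rule V_1E)
    have ev: "eval L (e j) = (\<Sum>i\<in>UNIV. l i * B $ i $ j)" for j
      by (simp add: L e_def column_def)
    have "L = (\<Sum>i\<in>UNIV. Const (l i) *
        (Const (B $ i $ 1) * x + Const (B $ i $ 2) * y + Const (B $ i $ 3) * z))"
      using L Var by simp
    then show "L = Const (eval L (e 1)) * x + Const (eval L (e 2)) * y + Const (eval L (e 3)) * z"
      unfolding ev by (simp add: sum_3 Const_add Const_mult algebra_simps)
  qed (use AB'[of 1] AB'[of 2] AB'[of 3] in \<open>simp_all add: x y z e_def column_def A\<close>)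
qed

lemma irreducible_imp_conic:
  assumes "Q \<in> V 2" "irreducible Q"
  shows "\<exists>x y z \<gamma> e1 e2 e3. conic Q x y z \<gamma> e1 e2 e3"
proof -
  have "Q \<noteq> 0" using assms(2) by auto
  then obtain \<gamma> y x z where *: "\<gamma> \<noteq> 0" "y \<in> V 1" "x \<in> V 1" "z \<in> V 1" "Q = Const \<gamma> * (y * y - x * z)"
    by (rule quadratic_form_normal_form[OF assms(1)])
  have indep: "a = 0 \<and> b = 0 \<and> c = 0" if "Const a * x + Const b * y + Const c * z = 0" for a b c
    using irreducible_normal_form_independent[OF assms(2) *(5) *(2-4), of b a c] that
    by (simp add: algebra_simps)
  show ?thesis
  proof (rule linear_independent_dual_basis[OF *(3,2,4) indep])
    fix e1 e2 e3
    assume "eval x e1 = 1" "eval x e2 = 0" "eval x e3 = 0"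
      "eval y e1 = 0" "eval y e2 = 1" "eval y e3 = 0"
      "eval z e1 = 0" "eval z e2 = 0" "eval z e3 = 1"
      "\<And>L. L \<in> V 1 \<Longrightarrow>
        L = Const (eval L e1) * x + Const (eval L e2) * y + Const (eval L e3) * z"
    then have "conic Q x y z \<gamma> e1 e2 e3" using * by (intro conic.intro)
    then show ?thesis by blast
  qed
qed

section \<open>Factorizations into quadratic polynomials\<close>

text \<open>
  Monic factors of degree at most \<open>2\<close> stand for binary quadratic forms up to scaling: a factor of degree
  \<open>1\<close> or \<open>0\<close> has one or two of its roots at infinity.
\<close>

definition factorizations :: "nat \<Rightarrow> complex poly \<Rightarrow> complex poly multiset set" where
  "factorizations k F = {M. size M = k \<and> prod_mset M = F \<and> (\<forall>q\<in>#M. lead_coeff q = 1 \<and> degree q \<le> 2)}"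

lemma factorizations_0: "factorizations 0 F \<subseteq> {{#}}"
  by (auto simp: factorizations_def)

lemma monic_degree_0: "lead_coeff q = 1 \<Longrightarrow> degree q = 0 \<Longrightarrow> q = (1 :: complex poly)"
  by (auto elim!: degree_eq_zeroE)

lemma monic_degree_1:
  assumes "lead_coeff q = 1" "degree q = 1"
  obtains s :: complex where "q = [:- s, 1:]"
proof -
  obtain a b where "q = [:a, b:]" using assms(2) degree1_coeffs by blast
  then show ?thesis using assms that[of "- a"] by (auto split: if_splits)
qed

lemma poly_prod_mset_eq_0_iff:
  fixes M :: "complex poly multiset"
  shows "poly (prod_mset M) r = 0 \<longleftrightarrow> (\<exists>q\<in>#M. poly q r = 0)"
  by (induction M) auto

lemma split_off_root:
  fixes F :: "complex poly"
  assumes "degree F > 0"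
  obtains r G where "F = [:- r, 1:] * G" "degree F = Suc (degree G)"
proof -
  have "\<not> constant (poly F)" using assms by (simp add: constant_degree)
  then obtain r where "poly F r = 0" using fundamental_theorem_of_algebra by blast
  then obtain G where G: "F = [:- r, 1:] * G" by (metis poly_eq_0_iff_dvd dvdE)
  then have "G \<noteq> 0" using assms by auto
  then have "degree F = Suc (degree G)" unfolding G by (subst degree_mult_eq) auto
  with G show ?thesis by (rule that)
qed

lemma lead_coeff_prod_mset:
  fixes M :: "complex poly multiset"
  assumes "\<forall>q\<in>#M. lead_coeff q = 1"
  shows "lead_coeff (prod_mset M) = 1"
  using assms by (induction M) (auto simp: lead_coeff_mult)

lemma degree_prod_mset_le:
  fixes M :: "complex poly multiset"
  assumes "\<forall>q\<in>#M. degree q \<le> 2"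
  shows "degree (prod_mset M) \<le> 2 * size M"
  using assms
proof (induction M)
  case (add q M)
  then show ?case using degree_mult_le[of q "prod_mset M"] by simp
qed simp

text \<open>
  Fix one root \<open>r\<close> of \<open>F\<close>, regarded as a binary form of degree \<open>2 k + 2\<close>.  Some factor vanishes at
  \<open>r\<close>, and its second root is one of the remaining \<open>2 k + 1\<close> roots of \<open>F\<close>; so one of at most
  \<open>2 k + 1\<close> quadratics occurs in every factorization.  The root \<open>r\<close> is taken to be infinity
  whenever infinity is a root.
\<close>

lemma factorizations_first_factor:
  fixes F :: "complex poly"
  shows "\<exists>D. finite D \<and> card D \<le> 2 * k + 1 \<and> 0 \<notin> D \<and>
    (\<forall>M\<in>factorizations (Suc k) F. \<exists>q\<in>D. q \<in># M)"
proof (cases "F = 0 \<or> degree F > 2 * Suc k")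
  case True
  have "factorizations (Suc k) F = {}"
  proof (intro equals0I)
    fix M assume "M \<in> factorizations (Suc k) F"
    then have "lead_coeff F = 1" "degree F \<le> 2 * Suc k"
      using lead_coeff_prod_mset[of M] degree_prod_mset_le[of M] by (auto simp: factorizations_def)
    then show False using True by auto
  qed
  then show ?thesis by (intro exI[of _ "{}"]) auto
next
  case False
  then have "F \<noteq> 0" and deg: "degree F \<le> 2 * Suc k" by auto
  show ?thesis
  proof (cases "degree F = 2 * Suc k")
    case True
    then obtain r G where G: "F = [:- r, 1:] * G" and "degree F = Suc (degree G)"
      using split_off_root[of F] by auto
    then have degG: "degree G = 2 * k + 1" using True by simp
    then have "G \<noteq> 0" by auto
    define D where "D = (\<lambda>s. [:- r, 1:] * [:- s, 1:]) ` {s. poly G s = 0}"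
    have fin: "finite {s. poly G s = 0}" by (rule poly_roots_finite[OF \<open>G \<noteq> 0\<close>])
    show ?thesis
    proof (intro exI[of _ D] conjI ballI)
      show "finite D" using fin by (simp add: D_def)
      have "card D \<le> card {s. poly G s = 0}" unfolding D_def by (rule card_image_le[OF fin])
      also have "\<dots> \<le> degree G" by (rule card_poly_roots_bound[OF \<open>G \<noteq> 0\<close>])
      finally show "card D \<le> 2 * k + 1" by (simp add: degG)
      show "0 \<notin> D" by (auto simp: D_def)
      fix M assume M: "M \<in> factorizations (Suc k) F"
      then have prod: "prod_mset M = F" by (simp add: factorizations_def)
      then have "poly (prod_mset M) r = 0" by (simp add: G)
      then obtain q where q: "q \<in># M" "poly q r = 0"
        by (auto simp: poly_prod_mset_eq_0_iff)
      obtain N where N: "M = add_mset q N" using q(1) by (metis mset_add)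
      have monic: "lead_coeff q = 1" and "degree q \<le> 2" and sz: "size N = k"
        and all: "\<forall>q\<in>#N. degree q \<le> 2"
        using M by (auto simp: factorizations_def N)
      obtain p where p: "q = [:- r, 1:] * p" using q(2) by (metis poly_eq_0_iff_dvd dvdE)
      have "p \<noteq> 0" using monic p by auto
      have "degree q = Suc (degree p)" unfolding p using \<open>p \<noteq> 0\<close> by (subst degree_mult_eq) auto
      moreover have "degree F \<le> degree q + 2 * k"
        using degree_mult_le[of q "prod_mset N"] degree_prod_mset_le[OF all] prod by (simp add: N sz)
      ultimately have "degree p = 1" using True \<open>degree q \<le> 2\<close> by simp
      moreover have "lead_coeff p = 1" using monic unfolding p lead_coeff_mult by simp
      ultimately obtain s where s: "p = [:- s, 1:]" using monic_degree_1 by blast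
      have "[:- r, 1:] * G = [:- r, 1:] * (p * prod_mset N)"
        using prod by (simp only: N prod_mset.add_mset p G mult.assoc)
      then have "G = p * prod_mset N" by (subst (asm) mult_cancel_left) simp
      then have "poly G s = 0" by (simp add: s)
      then have "q \<in> D" unfolding D_def using p s by blast
      then show "\<exists>q\<in>D. q \<in># M" using q(1) by blast
    qed
  next
    case False
    \<comment> \<open>The root at infinity is the fixed one here.  The constant factor \<open>1\<close> has infinity as a double root,
      so it is a candidate only if the degree of \<open>F\<close> drops by at least two.\<close>
    define R where "R = (\<lambda>s. [:- s, 1:]) ` {s. poly F s = 0}"
    define D where "D = (if degree F \<le> 2 * k then insert 1 R else R)"
    have fin: "finite {s. poly F s = 0}" by (rule poly_roots_finite[OF \<open>F \<noteq> 0\<close>])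
    then have finR: "finite R" by (simp add: R_def)
    have cardR: "card R \<le> degree F"
      unfolding R_def
      by (rule order_trans[OF card_image_le[OF fin] card_poly_roots_bound[OF \<open>F \<noteq> 0\<close>]])
    show ?thesis
    proof (intro exI[of _ D] conjI ballI)
      show "finite D" using finR by (simp add: D_def)
      show "card D \<le> 2 * k + 1"
        using card_insert_le_m1[of "degree F + 1" R 1] cardR finR False deg by (auto simp: D_def card_insert_if)
      show "0 \<notin> D" by (auto simp: D_def R_def)
      fix M assume M: "M \<in> factorizations (Suc k) F"
      then have prod: "prod_mset M = F" by (simp add: factorizations_def)
      have "\<exists>q\<in>#M. degree q \<le> 1"
      proof (rule ccontr)
        assume "\<not> ?thesis"
        then have all: "\<forall>q\<in>#M. degree q = 2 \<and> q \<noteq> 0"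
          using M by (force simp: factorizations_def)
        have "degree (prod_mset N) = 2 * size N \<and> prod_mset N \<noteq> 0"
          if "\<forall>q\<in>#N. degree q = 2 \<and> q \<noteq> 0" for N :: "complex poly multiset"
          using that by (induction N) (auto simp: degree_mult_eq)
        from this[OF all] show False using M False by (simp add: factorizations_def)
      qed
      then obtain q where q: "q \<in># M" "degree q \<le> 1" by blast
      obtain N where N: "M = add_mset q N" using q(1) by (metis mset_add)
      have monic: "lead_coeff q = 1" and sz: "size N = k" and all: "\<forall>q\<in>#N. degree q \<le> 2"
        using M by (auto simp: factorizations_def N)
      have "q \<in> D"
      proof (cases "degree q = 0")
        case True
        have "degree F \<le> degree q + 2 * k"
          using degree_mult_le[of q "prod_mset N"] degree_prod_mset_le[OF all] prod by (simp add: N sz)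
        then show ?thesis using True monic_degree_0[OF monic] by (simp add: D_def)
      next
        case False
        then have "degree q = 1" using q(2) by simp
        with monic obtain s where s: "q = [:- s, 1:]" by (rule monic_degree_1)
        then have "poly F s = 0" using prod by (auto simp: N)
        then show ?thesis using s by (auto simp: D_def R_def)
      qed
      then show "\<exists>q\<in>D. q \<in># M" using q(1) by blast
    qed
  qed
qed

lemma odd_double_fact_Suc: "odd_double_fact (Suc k) = (2 * k + 1) * odd_double_fact k"
  by (simp add: odd_double_fact_def)

text \<open>
  Removing the factor found among the \<open>2 k + 1\<close> candidates leaves a factorization with one factor less;
  this is the usual count of the perfect matchings of \<open>2 k\<close> points.
\<close>

lemma card_factorizations:
  "finite (factorizations k F) \<and> card (factorizations k F) \<le> odd_double_fact k"
proof (induction k arbitrary: F)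
  case 0
  have "card (factorizations 0 F) \<le> card {{#} :: complex poly multiset}"
    by (rule card_mono[OF _ factorizations_0]) simp
  then show ?case using finite_subset[OF factorizations_0] by (simp add: odd_double_fact_def)
next
  case (Suc k)
  obtain D where D: "finite D" "card D \<le> 2 * k + 1" "0 \<notin> D"
    "\<forall>M\<in>factorizations (Suc k) F. \<exists>q\<in>D. q \<in># M"
    using factorizations_first_factor[of k F] by auto
  define U where "U = (\<Union>q\<in>D. add_mset q ` factorizations k (F div q))"
  have sub: "factorizations (Suc k) F \<subseteq> U"
  proof
    fix M assume M: "M \<in> factorizations (Suc k) F"
    then obtain q where q: "q \<in> D" "q \<in># M" using D(4) by blast
    obtain N where N: "M = add_mset q N" using q(2) by (metis mset_add)
    have "F = q * prod_mset N" "q \<noteq> 0" using M q(1) D(3) by (auto simp: factorizations_def N)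
    then have "N \<in> factorizations k (F div q)" using M by (auto simp: factorizations_def N)
    then show "M \<in> U" using q(1) by (auto simp: U_def N)
  qed
  have fin: "finite U" using D(1) Suc.IH by (auto simp: U_def)
  have "card U \<le> (\<Sum>q\<in>D. card (add_mset q ` factorizations k (F div q)))"
    unfolding U_def by (rule card_UN_le[OF D(1)])
  also have "\<dots> \<le> (\<Sum>q\<in>D. odd_double_fact k)"
    by (intro sum_mono) (meson Suc.IH card_image_le order_trans)
  also have "\<dots> \<le> odd_double_fact (Suc k)"
    using mult_le_mono1[OF D(2), of "odd_double_fact k"] by (simp add: odd_double_fact_Suc)
  finally have "card U \<le> odd_double_fact (Suc k)" .
  then show ?case using finite_subset[OF sub fin] card_mono[OF fin sub] by simp
qed

text \<open>
  Two roots are split off at a time; once the degree is used up, the remaining factors are constant.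
\<close>

lemma splits_into_quadratics:
  fixes F :: "complex poly"
  assumes "degree F \<le> 2 * k" "k > 0"
  obtains q where "\<And>l. l \<in> {1..k} \<Longrightarrow> degree (q l) \<le> 2" "F = (\<Prod>l\<in>{1..k}. q l)"
proof -
  have "\<exists>q. (\<forall>l\<in>{1..k}. degree (q l) \<le> 2) \<and> F = (\<Prod>l\<in>{1..k}. q l)"
    using assms(2,1)
  proof (induction k arbitrary: F rule: nat_induct_non_zero)
    case 1
    then show ?case by (intro exI[of _ "\<lambda>_. F"]) simp
  next
    case (Suc k)
    have "\<exists>G p. F = G * p \<and> degree p \<le> 2 \<and> degree G \<le> 2 * k"
    proof (cases "degree F \<le> 2")
      case True
      then show ?thesis using Suc.hyps by (intro exI[of _ 1] exI[of _ F]) simp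
    next
      case False
      obtain r G where G: "F = [:- r, 1:] * G" "degree F = Suc (degree G)"
        using split_off_root[of F] False by auto
      obtain s H where H: "G = [:- s, 1:] * H" "degree G = Suc (degree H)"
        using split_off_root[of G] False G by auto
      have "F = H * ([:- r, 1:] * [:- s, 1:])" by (simp only: G H mult_ac)
      moreover have "degree ([:- r, 1:] * [:- s, 1:]) \<le> 2"
        using degree_mult_le[of "[:- r, 1:]" "[:- s, 1:]"] by simp
      ultimately show ?thesis using Suc.prems G H by (intro exI[of _ H] exI[of _ "[:- r, 1:] * [:- s, 1:]"]) auto
    qed
    then obtain G p where Gp: "F = G * p" "degree p \<le> 2" "degree G \<le> 2 * k" by blast
    from Suc.IH[OF Gp(3)] obtain q where
      q: "\<forall>l\<in>{1..k}. degree (q l) \<le> 2" "G = (\<Prod>l\<in>{1..k}. q l)" by blast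
    show ?case
    proof (intro exI[of _ "q(Suc k := p)"] conjI)
      have "(\<Prod>l\<in>{1..k}. (q(Suc k := p)) l) = (\<Prod>l\<in>{1..k}. q l)" by (intro prod.cong) auto
      then show "F = (\<Prod>l\<in>{1..Suc k}. (q(Suc k := p)) l)" by (simp add: Gp(1) q(2))
    qed (use q(1) Gp(2) in auto)
  qed
  then show ?thesis using that by blast
qed

definition monic :: "complex poly \<Rightarrow> complex poly" where
  "monic q = smult (inverse (lead_coeff q)) q"

lemma monic_mult: "monic (p * q) = monic p * monic q"
  by (simp add: monic_def lead_coeff_mult mult.commute)

lemma monic_prod: "monic (\<Prod>l\<in>A. q l) = (\<Prod>l\<in>A. monic (q l))"
  by (induction A rule: infinite_finite_induct) (simp_all add: monic_mult, simp_all add: monic_def)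

lemma lead_coeff_monic: "q \<noteq> 0 \<Longrightarrow> lead_coeff (monic q) = 1"
  by (simp add: monic_def)

lemma monic_eq_imp_proportional:
  assumes "monic p = monic q" "p \<noteq> 0" "q \<noteq> 0"
  obtains c where "c \<noteq> 0" "p = smult c q"
proof
  have "p = smult (lead_coeff p) (monic p)" using assms(2) by (simp add: monic_def)
  also have "\<dots> = smult (lead_coeff p * inverse (lead_coeff q)) q"
    unfolding assms(1) by (simp add: monic_def)
  finally show "p = smult (lead_coeff p * inverse (lead_coeff q)) q" .
  show "lead_coeff p * inverse (lead_coeff q) \<noteq> 0" using assms by simp
qed

section \<open>Multipoles\<close>

lemma multipoles_tuples: "u \<in> multipoles k \<Longrightarrow> L \<in> u \<Longrightarrow> L \<in> tuples k"
  unfolding multipoles_def using in_quotient_imp_subset[OF equiv_multipole_rel] by blast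

lemma multipoles_nonempty: "u \<in> multipoles k \<Longrightarrow> \<exists>L. L \<in> u"
  unfolding multipoles_def using in_quotient_imp_non_empty[OF equiv_multipole_rel] by blast

lemma tuples_linear: "L \<in> tuples k \<Longrightarrow> l \<in> {1..k} \<Longrightarrow> L l \<in> V 1"
  and tuples_nonzero: "L \<in> tuples k \<Longrightarrow> l \<in> {1..k} \<Longrightarrow> L l \<noteq> 0"
  unfolding tuples_def by auto

lemma Theta_V:
  assumes "u \<in> multipoles k"
  shows "Theta k u \<in> V k"
proof -
  obtain L where L: "L \<in> u" using multipoles_nonempty[OF assms] by blast
  then have "(\<Prod>l\<in>{1..k}. L l) \<in> V (card {1..k})"
    using tuples_linear multipoles_tuples[OF assms] by (intro V_prod) auto
  then show ?thesis by (simp add: Theta_class[OF assms L])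
qed

lemma Theta0_V: "w \<in> multipoles0 k \<Longrightarrow> Theta0 k w \<in> V k"
  by (auto simp: multipoles0_def Theta0_def Theta_V)

text \<open>
  The two tuples are joined by two moves of the orbit relation, a permutation and then a rescaling.  The tuple
  in between is admissible because the moves are symmetric.
\<close>

lemma multipole_eqI:
  assumes u: "u \<in> multipoles k" "L \<in> u" and u': "u' \<in> multipoles k" "L' \<in> u'"
    and \<pi>: "\<pi> permutes {1..k}"
    and scale: "\<And>l. l \<in> {1..k} \<Longrightarrow> L' l = Const (c l) * L (\<pi> l)"
    and c: "\<And>l. l \<in> {1..k} \<Longrightarrow> c l \<noteq> 0" "(\<Prod>l\<in>{1..k}. c l) = 1"
  shows "u = u'"
proof -
  note L = multipoles_tuples[OF u] and L' = multipoles_tuples[OF u']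
  have step1: "(L, L \<circ> \<pi>) \<in> permute_moves k"
    unfolding permute_moves_def using L \<pi> by blast
  then have "(L \<circ> \<pi>, L) \<in> permute_moves k \<union> rescale_moves k"
    using sym_moves[of k] by (auto dest: symD)
  then have "L \<circ> \<pi> \<in> tuples k" by (auto simp: permute_moves_def rescale_moves_def)
  moreover have "L' = (\<lambda>l\<in>{1..k}. Const (c l) * (L \<circ> \<pi>) l)"
  proof
    fix l
    show "L' l = (\<lambda>l\<in>{1..k}. Const (c l) * (L \<circ> \<pi>) l) l"
      using scale[of l] PiE_arb[OF L'[unfolded tuples_def], of l] by (cases "l \<in> {1..k}") auto
  qed
  ultimately have step2: "(L \<circ> \<pi>, L') \<in> rescale_moves k"
    unfolding rescale_moves_def using c by blast
  have "(L, L') \<in> (permute_moves k \<union> rescale_moves k)\<^sup>*"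
    using step1 step2 by (meson UnCI r_into_rtrancl rtrancl_trans)
  then have "(L, L') \<in> multipole_rel k" using L L' by (simp add: multipole_rel_def)
  then show ?thesis
    using quotient_eqI[OF equiv_multipole_rel] u u' unfolding multipoles_def by blast
qed

section \<open>Leading forms on the level surface\<close>

context conic
begin

lemma Q_V: "Q \<in> V 2"
  using V_Const_mult[OF V_diff[OF V_mult[OF forms(2,2)] V_mult[OF forms(1,3)]], of \<gamma>]
  by (simp add: Q numeral_2_eq_2)

text \<open>
  The line through a point \<open>(1, t, t\<^sup>2)\<close> of the cone \<open>Q = 0\<close> in the direction \<open>- e3 / \<gamma>\<close>:
  at parameter \<open>\<epsilon>\<^sup>2\<close> the form \<open>Q\<close> has the value \<open>\<epsilon>\<^sup>2\<close>, so division by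
  \<open>\<epsilon>\<close> lands on the surface.
\<close>

lemma surface_point:
  assumes "\<epsilon> \<noteq> 0"
  shows "(\<chi> i. inverse \<epsilon> * (e1 $ i + t * (e2 $ i + t * e3 $ i) + \<epsilon>\<^sup>2 * (- inverse \<gamma> * e3 $ i)))
    \<in> level_surface Q"
proof -
  define u where "u = (\<chi> i. e1 $ i + t * (e2 $ i + t * e3 $ i))"
  define w where "w = (\<chi> i. 1 * u $ i + (- \<epsilon>\<^sup>2 * inverse \<gamma>) * e3 $ i)"
  have "eval x u = 1" "eval y u = t" "eval z u = t * t"
    unfolding u_def poly_pullback[symmetric] by (simp_all add: pullback_x pullback_y pullback_z)
  then have "eval x w = 1" "eval y w = t" "eval z w = t * t - \<epsilon>\<^sup>2 * inverse \<gamma>"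
    unfolding w_def eval_linear_combination[OF forms(1)] eval_linear_combination[OF forms(2)]
      eval_linear_combination[OF forms(3)] by (simp_all add: dual)
  then have "eval Q w = \<epsilon>\<^sup>2" using \<gamma> by (simp add: Q)
  then have "eval Q (\<chi> i. inverse \<epsilon> * w $ i) = 1"
    unfolding eval_scale_homogeneous[OF Q_V] using assms by (simp add: power_inverse)
  then show ?thesis by (simp add: level_surface_def w_def u_def mult.assoc)
qed

text \<open>
  The surface approaches the cone \<open>Q = 0\<close> at infinity, where the leading form dominates.  Evaluating at the
  points of \<open>surface_point\<close> and clearing the powers of \<open>\<epsilon>\<close> gives a polynomial in
  \<open>\<epsilon>\<close> that vanishes for \<open>\<epsilon> \<noteq> 0\<close>, hence also at \<open>\<epsilon> = 0\<close>, where its value is that of the leading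
  form on the cone.
\<close>

lemma leading_form_dvd:
  assumes f: "\<And>k. k \<le> d \<Longrightarrow> f k \<in> V k"
    and vanish: "\<And>v. v \<in> level_surface Q \<Longrightarrow> (\<Sum>k\<le>d. eval (f k) v) = 0"
  shows "Q dvd f d"
proof -
  have "poly (pullback (f d)) t = 0" for t
  proof -
    define u where "u i = e1 $ i + t * (e2 $ i + t * e3 $ i)" for i
    \<comment> \<open>The line of \<open>surface_point\<close> at parameter \<open>\<epsilon>\<^sup>2\<close>.  By homogeneity the value of the
      following \<open>q\<close> at \<open>\<epsilon>\<close> is \<open>\<epsilon> ^ d\<close> times the given sum at a surface point.\<close>
    define h where "h i = [:u i, 0, - inverse \<gamma> * e3 $ i:]" for i
    define q where "q = (\<Sum>k\<le>d. monom 1 (d - k) * psubst h (f k))"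
    have "poly q \<epsilon> = 0" if "\<epsilon> \<noteq> 0" for \<epsilon>
    proof -
      define v where "v = (\<chi> i. inverse \<epsilon> * (u i + \<epsilon>\<^sup>2 * (- inverse \<gamma> * e3 $ i)))"
      have w: "(\<chi> i. poly (h i) \<epsilon>) = (\<chi> i. \<epsilon> * v $ i)"
        using that by (simp add: h_def v_def vec_eq_iff power2_eq_square flip: mult.assoc)
      have "poly q \<epsilon> = (\<Sum>k\<le>d. \<epsilon> ^ (d - k) * (\<epsilon> ^ k * eval (f k) v))"
        unfolding q_def poly_sum poly_mult poly_psubst w
        by (intro sum.cong refl) (simp add: poly_monom eval_scale_homogeneous[OF f])
      also have "\<dots> = \<epsilon> ^ d * (\<Sum>k\<le>d. eval (f k) v)"
        unfolding sum_distrib_left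
        by (intro sum.cong refl) (simp flip: mult.assoc power_add)
      also have "(\<Sum>k\<le>d. eval (f k) v) = 0"
        unfolding v_def u_def by (intro vanish surface_point that)
      finally show ?thesis by simp
    qed
    then have "UNIV - {0} \<subseteq> {\<epsilon>. poly q \<epsilon> = 0}" by blast
    moreover have "infinite (UNIV - {0 :: complex})" by (simp add: infinite_UNIV_char_0)
    ultimately have "q = 0" using poly_roots_finite[of q] finite_subset by blast
    then have "0 = poly q 0" by simp
    also have "\<dots> = (\<Sum>k\<le>d. 0 ^ (d - k) * eval (f k) (\<chi> i. u i))"
      by (simp add: q_def poly_sum poly_psubst poly_monom h_def)
    also have "\<dots> = (\<Sum>k\<le>d. if k = d then eval (f k) (\<chi> i. u i) else 0)"
      by (intro sum.cong refl) auto
    also have "\<dots> = poly (pullback (f d)) t" by (simp add: poly_pullback u_def[abs_def])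
    finally show ?thesis by simp
  qed
  then have "pullback (f d) = 0" using poly_all_0_iff_0 by blast
  then show ?thesis using Q_dvd_iff[OF f] by blast
qed

subsection \<open>Fibres of the product map modulo \<open>Q\<close>\<close>

lemma pullback_Theta_nonzero:
  assumes "u \<in> multipoles k"
  shows "pullback (Theta k u) \<noteq> 0"
proof -
  obtain L where L: "L \<in> u" using multipoles_nonempty[OF assms] by blast
  then have "L \<in> tuples k" by (rule multipoles_tuples[OF assms])
  then have "pullback (L l) \<noteq> 0" if "l \<in> {1..k}" for l
    using that by (intro pullback_linear_nonzero tuples_linear tuples_nonzero)
  then show ?thesis by (simp add: Theta_class[OF assms L])
qed

text \<open>
  A multipole is determined by the monic multiples of the restrictions of its linear forms: equal
  multisets give a permutation and proportionality factors, the factors carry over to the linear forms because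
  restriction is injective on these, and their product is \<open>1\<close> because both products restrict to
  \<open>F\<close>.
\<close>

lemma multipoles_same_pullback:
  assumes F: "F \<noteq> 0"
  shows "finite {u \<in> multipoles k. pullback (Theta k u) = F} \<and>
    card {u \<in> multipoles k. pullback (Theta k u) = F} \<le> odd_double_fact k"
proof -
  define B where "B = {u \<in> multipoles k. pullback (Theta k u) = F}"
  define rep where "rep u = (SOME L. L \<in> u)" for u :: multipole
  define N where "N u = image_mset (\<lambda>l. monic (pullback (rep u l))) (mset_set {1..k})" for u
  have B: "u \<in> multipoles k" "rep u \<in> u" "rep u \<in> tuples k"
    "(\<Prod>l\<in>{1..k}. pullback (rep u l)) = F" if "u \<in> B" for u
  proof -
    show u: "u \<in> multipoles k" using that by (simp add: B_def)
    show r: "rep u \<in> u" unfolding rep_def using multipoles_nonempty[OF u] by (rule someI_ex)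
    show "rep u \<in> tuples k" by (rule multipoles_tuples[OF u r])
    show "(\<Prod>l\<in>{1..k}. pullback (rep u l)) = F"
      using that Theta_class[OF u r] by (simp add: B_def)
  qed
  have nonzero: "pullback (rep u l) \<noteq> 0" if "u \<in> B" "l \<in> {1..k}" for u l
    using that B(3) by (intro pullback_linear_nonzero tuples_linear tuples_nonzero)
  have "N u \<in> factorizations k (monic F)" if u: "u \<in> B" for u
  proof -
    have "prod_mset (N u) = monic F"
      unfolding B(4)[OF u, symmetric] by (simp add: N_def monic_prod flip: prod_unfold_prod_mset)
    moreover have "degree (monic (pullback (rep u l))) \<le> 2" if "l \<in> {1..k}" for l
      using pullback_linear[OF tuples_linear[OF B(3)[OF u] that]] by (simp add: monic_def)
    ultimately show ?thesis
      using nonzero[OF u] lead_coeff_monic by (auto simp: factorizations_def N_def)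
  qed
  then have image: "N ` B \<subseteq> factorizations k (monic F)" by blast
  have inj: "inj_on N B"
  proof (rule inj_onI)
    fix u u' assume u: "u \<in> B" and u': "u' \<in> B" and "N u = N u'"
    then have "N u' = N u" by simp
    then obtain \<pi> where \<pi>: "\<pi> permutes {1..k}"
      and eq: "\<forall>l\<in>{1..k}. monic (pullback (rep u' l)) = monic (pullback (rep u (\<pi> l)))"
      unfolding N_def by (rule image_mset_eq_implies_permutes[OF finite_atLeastAtMost])
    have mem: "\<pi> l \<in> {1..k}" if "l \<in> {1..k}" for l using permutes_in_image[OF \<pi>] that by blast
    have "\<exists>c. c \<noteq> 0 \<and> pullback (rep u' l) = smult c (pullback (rep u (\<pi> l)))" if "l \<in> {1..k}" for l
      using monic_eq_imp_proportional[OF bspec[OF eq that] nonzero[OF u' that] nonzero[OF u mem[OF that]]]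
      by blast
    then obtain c where c: "\<And>l. l \<in> {1..k} \<Longrightarrow> c l \<noteq> 0"
      and proportional: "\<And>l. l \<in> {1..k} \<Longrightarrow> pullback (rep u' l) = smult (c l) (pullback (rep u (\<pi> l)))"
      by metis
    have scale: "rep u' l = Const (c l) * rep u (\<pi> l)" if l: "l \<in> {1..k}" for l
    proof (rule pullback_linear_inj)
      show "rep u' l \<in> V 1" by (rule tuples_linear[OF B(3)[OF u'] l])
      show "Const (c l) * rep u (\<pi> l) \<in> V 1"
        by (rule V_Const_mult[OF tuples_linear[OF B(3)[OF u] mem[OF l]]])
      show "pullback (rep u' l) = pullback (Const (c l) * rep u (\<pi> l))" by (simp add: proportional[OF l])
    qed
    have "F = (\<Prod>l\<in>{1..k}. smult (c l) (pullback (rep u (\<pi> l))))"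
      using B(4)[OF u'] proportional by simp
    also have "\<dots> = smult (\<Prod>l\<in>{1..k}. c l) (\<Prod>l\<in>{1..k}. pullback (rep u (\<pi> l)))"
      by (rule prod_smult)
    also have "(\<Prod>l\<in>{1..k}. pullback (rep u (\<pi> l))) = F"
      using prod.permute[OF \<pi>, of "\<lambda>l. pullback (rep u l)"] B(4)[OF u] by (simp add: o_def)
    finally have "smult ((\<Prod>l\<in>{1..k}. c l) - 1) F = 0" by (simp add: smult_diff_left)
    then have "(\<Prod>l\<in>{1..k}. c l) = 1" using F by simp
    with multipole_eqI[OF B(1,2)[OF u] B(1,2)[OF u'] \<pi> scale c] show "u = u'" by blast
  qed
  have fin: "finite (factorizations k (monic F))" and
    card: "card (factorizations k (monic F)) \<le> odd_double_fact k"
    using card_factorizations by blast+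
  show ?thesis
    unfolding B_def[symmetric]
    using inj_on_finite[OF inj image fin] card_inj_on_le[OF inj image fin] card by linarith
qed

lemma odd_double_fact_pos: "odd_double_fact k \<ge> 1"
  by (induction k) (simp_all add: odd_double_fact_Suc, simp add: odd_double_fact_def)

text \<open>
  A product of non-zero linear forms is never divisible by \<open>Q\<close>.  So the zero multipole is alone in its
  fibre, and the other fibres consist of multipoles with a common non-zero restriction to the conic.
\<close>

lemma card_fibre:
  assumes f: "f \<in> V k"
  shows "finite {w \<in> multipoles0 k. Q dvd Theta0 k w - f} \<and>
    card {w \<in> multipoles0 k. Q dvd Theta0 k w - f} \<le> odd_double_fact k"
proof -
  have dvd: "Q dvd Theta0 k w - f \<longleftrightarrow> pullback (Theta0 k w) = pullback f" if "w \<in> multipoles0 k" for w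
    using Q_dvd_iff[OF V_diff[OF Theta0_V[OF that] f]] by simp
  show ?thesis
  proof (cases "pullback f = 0")
    case True
    have "{w \<in> multipoles0 k. Q dvd Theta0 k w - f} \<subseteq> {None}"
      using dvd pullback_Theta_nonzero True
      by (fastforce simp: multipoles0_def Theta0_def split: option.splits)
    from finite_subset[OF this] card_mono[OF _ this] show ?thesis
      using odd_double_fact_pos[of k] by simp
  next
    case False
    define B where "B = {u \<in> multipoles k. pullback (Theta k u) = pullback f}"
    have sub: "{w \<in> multipoles0 k. Q dvd Theta0 k w - f} \<subseteq> Some ` B"
      using dvd False by (fastforce simp: multipoles0_def Theta0_def B_def split: option.splits)
    have B: "finite B" "card B \<le> odd_double_fact k"
      unfolding B_def using multipoles_same_pullback[OF False] by blast+
    then have "finite (Some ` B)" "card (Some ` B) \<le> odd_double_fact k"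
      using card_image_le[of B Some] by auto
    then show ?thesis using finite_subset[OF sub] card_mono[OF _ sub] by force
  qed
qed

subsection \<open>Representing a function on the surface\<close>

text \<open>
  Split the restriction of \<open>f\<close> to the conic into polynomials of degree at most \<open>2\<close>; each of these is
  the restriction of a linear form.
\<close>

lemma congruent_to_product:
  assumes "f \<in> V k" "k > 0"
  obtains L g where "\<And>l. l \<in> {1..k} \<Longrightarrow> L l \<in> V 1" "g \<in> V_minus2 k"
    "f = (\<Prod>l\<in>{1..k}. L l) + Q * g"
proof -
  have "degree (pullback f) \<le> 2 * k" using cong_lift_pullback[OF assms(1)] by blast
  then obtain q where q: "\<And>l. l \<in> {1..k} \<Longrightarrow> degree (q l) \<le> 2" "pullback f = (\<Prod>l\<in>{1..k}. q l)"
    using splits_into_quadratics assms(2) by blast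
  have "\<exists>L. L \<in> V 1 \<and> pullback L = q l" if "l \<in> {1..k}" for l
    using pullback_linear_surj[OF q(1)[OF that]] by blast
  then obtain L where L: "\<And>l. l \<in> {1..k} \<Longrightarrow> L l \<in> V 1" "\<And>l. l \<in> {1..k} \<Longrightarrow> pullback (L l) = q l"
    by metis
  have "(\<Prod>l\<in>{1..k}. L l) \<in> V (card {1..k})" by (intro V_prod L(1)) simp
  then have "f - (\<Prod>l\<in>{1..k}. L l) \<in> V k" by (intro V_diff assms(1)) simp
  moreover have "pullback (f - (\<Prod>l\<in>{1..k}. L l)) = 0" using q(2) L(2) by simp
  ultimately obtain g where g: "g \<in> V_minus2 k" "f - (\<Prod>l\<in>{1..k}. L l) = Q * g"
    by (rule kernel_pullback)
  show ?thesis by (rule that[OF L(1) g(1)]) (use g(2) in \<open>auto simp: algebra_simps\<close>)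
qed

text \<open>
  The leading form is a product plus \<open>Q g\<close> with \<open>g\<close> of smaller degree.  On the surface \<open>Q g\<close> equals
  \<open>g\<close> and joins the lower terms.
\<close>

lemma representation_exists:
  assumes "\<And>m. m \<in> Poly_Mapping.keys P \<Longrightarrow> mono_degree m \<le> d"
  shows "\<exists>c L. (\<forall>k\<in>{1..d}. \<forall>l\<in>{1..k}. L k l \<in> V 1) \<and>
    (\<forall>v\<in>level_surface Q. eval P v = eval (Const c + (\<Sum>k\<in>{1..d}. \<Prod>l\<in>{1..k}. L k l)) v)"
  using assms
proof (induction d arbitrary: P)
  case 0
  then have "P \<in> V 0" by (auto simp: V_def)
  then obtain c where "P = Const c" by (rule V_0E)
  then show ?case by auto
next
  case (Suc d)
  obtain T R where TR: "P = T + R" "T \<in> V (Suc d)"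
    "\<And>m. m \<in> Poly_Mapping.keys R \<Longrightarrow> mono_degree m \<le> d"
    using split_leading_form[OF Suc.prems] by blast
  obtain M g where M: "\<And>l. l \<in> {1..Suc d} \<Longrightarrow> M l \<in> V 1" "g \<in> V_minus2 (Suc d)"
    "T = (\<Prod>l\<in>{1..Suc d}. M l) + Q * g"
    using congruent_to_product[OF TR(2)] by blast
  have "mono_degree m \<le> d" if "m \<in> Poly_Mapping.keys (g + R)" for m
    using that Poly_Mapping.keys_add[of g R] TR(3) M(2) by (force simp: V_minus2_def)
  from Suc.IH[OF this] obtain c L where L: "\<forall>k\<in>{1..d}. \<forall>l\<in>{1..k}. L k l \<in> V 1"
    "\<forall>v\<in>level_surface Q. eval (g + R) v = eval (Const c + (\<Sum>k\<in>{1..d}. \<Prod>l\<in>{1..k}. L k l)) v"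
    by blast
  define L' where "L' = L(Suc d := M)"
  have L': "L' (Suc d) = M" "\<And>k. k \<in> {1..d} \<Longrightarrow> L' k = L k" by (auto simp: L'_def)
  show ?case
  proof (intro exI[of _ c] exI[of _ L'] conjI ballI)
    fix k l assume "k \<in> {1..Suc d}" "l \<in> {1..k}"
    then show "L' k l \<in> V 1" using L(1) M(1) by (cases "k = Suc d") (auto simp: L'_def)
  next
    fix v assume v: "v \<in> level_surface Q"
    have "eval P v = eval (\<Prod>l\<in>{1..Suc d}. M l) v + eval (g + R) v"
      using v by (simp only: TR(1) M(3) eval_add eval_mult level_surface_def mem_Collect_eq)
        (simp add: algebra_simps)
    also have "\<dots> = eval (Const c + ((\<Sum>k\<in>{1..d}. \<Prod>l\<in>{1..k}. L' k l) + (\<Prod>l\<in>{1..Suc d}. L' (Suc d) l))) v"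
      using L(2) v by (simp only: eval_add L'(1)) (simp add: L'(2))
    also have "(\<Sum>k\<in>{1..d}. \<Prod>l\<in>{1..k}. L' k l) + (\<Prod>l\<in>{1..Suc d}. L' (Suc d) l)
        = (\<Sum>k\<in>{1..Suc d}. \<Prod>l\<in>{1..k}. L' k l)"
      by (subst sum.cl_ivl_Suc) simp
    finally show "eval P v = eval (Const c + (\<Sum>k\<in>{1..Suc d}. \<Prod>l\<in>{1..k}. L' k l)) v" .
  qed
qed

text \<open>
  The sequences are considered for an arbitrary function on the surface, so that the leading product can be subtracted
  in an induction on \<open>d\<close>.
\<close>

definition seqs_representing :: "(complex ^ 3 \<Rightarrow> complex) \<Rightarrow> nat \<Rightarrow> (nat \<Rightarrow> multipole option) set" where
  "seqs_representing F d = {w \<in> (\<Pi>\<^sub>E k\<in>{1..d}. multipoles0 k).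
     \<exists>c. \<forall>v\<in>level_surface Q. F v = c + (\<Sum>k\<in>{1..d}. eval (Theta0 k (w k)) v)}"

lemma seqs_representing_top:
  assumes w: "w \<in> seqs_representing F (Suc d)" and w': "w' \<in> seqs_representing F (Suc d)"
  shows "Q dvd Theta0 (Suc d) (w (Suc d)) - Theta0 (Suc d) (w' (Suc d))"
proof -
  obtain c c' where
    c: "\<forall>v\<in>level_surface Q. F v = c + (\<Sum>k\<in>{1..Suc d}. eval (Theta0 k (w k)) v)" and
    c': "\<forall>v\<in>level_surface Q. F v = c' + (\<Sum>k\<in>{1..Suc d}. eval (Theta0 k (w' k)) v)"
    using w w' by (auto simp: seqs_representing_def)
  have V: "Theta0 k (w k) \<in> V k" "Theta0 k (w' k) \<in> V k" if "k \<in> {1..Suc d}" for k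
    using w w' that by (auto simp: seqs_representing_def intro!: Theta0_V dest: PiE_mem)
  \<comment> \<open>The additive constants are the components of degree zero.\<close>
  define f where "f k = (if k = 0 then Const (c - c') else Theta0 k (w k) - Theta0 k (w' k))" for k
  have "Q dvd f (Suc d)"
  proof (rule leading_form_dvd)
    fix k assume "k \<le> Suc d"
    then show "f k \<in> V k" using V_Const V[of k] by (auto simp: f_def intro!: V_diff)
  next
    fix v assume v: "v \<in> level_surface Q"
    have "{..Suc d} = insert 0 {1..Suc d}" by auto
    then have "(\<Sum>k\<le>Suc d. eval (f k) v) = (c - c') + (\<Sum>k\<in>{1..Suc d}. eval (f k) v)"
      by (simp add: f_def)
    also have "(\<Sum>k\<in>{1..Suc d}. eval (f k) v)
        = (\<Sum>k\<in>{1..Suc d}. eval (Theta0 k (w k)) v - eval (Theta0 k (w' k)) v)"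
      by (intro sum.cong) (auto simp: f_def)
    also have "c - c' + \<dots> = 0"
      using bspec[OF c v] bspec[OF c' v] unfolding sum_subtractf by (simp add: algebra_simps)
    finally show "(\<Sum>k\<le>Suc d. eval (f k) v) = 0" .
  qed
  then show ?thesis by (simp add: f_def)
qed

text \<open>
  By \<open>leading_form_dvd\<close> all representing sequences have leading products in one class modulo \<open>Q\<close>, which leaves
  \<open>(2 d - 1)!!\<close> leading multipoles; each of them fixes the function that the shorter sequence has to
  represent.
\<close>

lemma card_seqs_representing:
  "finite (seqs_representing F d) \<and> card (seqs_representing F d) \<le> (\<Prod>k\<in>{1..d}. odd_double_fact k)"
proof (induction d arbitrary: F)
  case 0
  have "seqs_representing F 0 \<subseteq> {\<lambda>_. undefined}" by (auto simp: seqs_representing_def)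
  from finite_subset[OF this] card_mono[OF _ this] show ?case by simp
next
  case (Suc d)
  show ?case
  proof (cases "seqs_representing F (Suc d) = {}")
    case True
    then show ?thesis by simp
  next
    case False
    then obtain w' where w': "w' \<in> seqs_representing F (Suc d)" by blast
    define f where "f = Theta0 (Suc d) (w' (Suc d))"
    define A where "A = {u \<in> multipoles0 (Suc d). Q dvd Theta0 (Suc d) u - f}"
    define S where "S u = seqs_representing (\<lambda>v. F v - eval (Theta0 (Suc d) u) v) d" for u
    define U where "U = (\<Union>u\<in>A. (\<lambda>w. w(Suc d := u)) ` S u)"
    have "f \<in> V (Suc d)"
      unfolding f_def using w' by (auto simp: seqs_representing_def intro!: Theta0_V dest: PiE_mem)
    then have A: "finite A" "card A \<le> odd_double_fact (Suc d)"
      unfolding A_def using card_fibre by blast+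
    have sub: "seqs_representing F (Suc d) \<subseteq> U"
    proof
      fix w assume w: "w \<in> seqs_representing F (Suc d)"
      then obtain c where c: "\<And>v. v \<in> level_surface Q \<Longrightarrow>
          F v = c + (\<Sum>k\<in>{1..Suc d}. eval (Theta0 k (w k)) v)"
        and PiE: "w \<in> (\<Pi>\<^sub>E k\<in>{1..Suc d}. multipoles0 k)"
        by (auto simp: seqs_representing_def)
      have "w (Suc d) \<in> A"
        unfolding A_def f_def using seqs_representing_top[OF w w'] PiE_mem[OF PiE, of "Suc d"] by simp
      moreover have "restrict w {1..d} \<in> S (w (Suc d))"
        unfolding S_def seqs_representing_def using PiE c
        by (auto intro!: exI[of _ c] simp: PiE_iff)
      moreover have "w = (restrict w {1..d})(Suc d := w (Suc d))"
        using PiE_arb[OF PiE] by (auto simp: fun_eq_iff)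
      ultimately show "w \<in> U" unfolding U_def by blast
    qed
    have finU: "finite U" unfolding U_def S_def using A(1) Suc.IH by blast
    have "card U \<le> (\<Sum>u\<in>A. card ((\<lambda>w. w(Suc d := u)) ` S u))"
      unfolding U_def by (rule card_UN_le[OF A(1)])
    also have "\<dots> \<le> (\<Sum>u\<in>A. \<Prod>k\<in>{1..d}. odd_double_fact k)"
      unfolding S_def by (intro sum_mono) (meson Suc.IH card_image_le order_trans)
    also have "\<dots> \<le> (\<Prod>k\<in>{1..Suc d}. odd_double_fact k)"
      using mult_le_mono1[OF A(2), of "\<Prod>k\<in>{1..d}. odd_double_fact k"] by (simp add: mult.commute)
    finally show ?thesis using finite_subset[OF sub finU] card_mono[OF finU sub] by linarith
  qed
qed

text \<open>
  The class is non-zero because the restrictions of the factors to the conic are non-zero polynomials.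
\<close>

lemma product_multipole:
  assumes L: "\<And>l. l \<in> {1..k} \<Longrightarrow> L l \<in> V 1" and nz: "(\<Prod>l\<in>{1..k}. L l) \<noteq> 0"
  shows "\<exists>w\<in>multipoles k. restrict L {1..k} \<in> w \<and> Theta k w = (\<Prod>l\<in>{1..k}. L l) \<and>
    Phi Q k w = class_Q Q k (\<Prod>l\<in>{1..k}. L l) \<and> Phi Q k w \<in> quot_Q Q k - {class_Q Q k 0}"
proof -
  have "L l \<noteq> 0" if "l \<in> {1..k}" for l using nz that prod_zero[of "{1..k}" L] by auto
  then have tup: "restrict L {1..k} \<in> tuples k" using L by (auto simp: tuples_def)
  define w where "w = multipole_rel k `` {restrict L {1..k}}"
  have w: "w \<in> multipoles k" unfolding w_def multipoles_def by (rule quotientI[OF tup])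
  have mem: "restrict L {1..k} \<in> w"
    unfolding w_def by (rule equiv_class_self[OF equiv_multipole_rel tup])
  have Theta: "Theta k w = (\<Prod>l\<in>{1..k}. L l)" unfolding Theta_class[OF w mem] by simp
  have "Phi Q k w \<in> quot_Q Q k"
    unfolding Phi_def class_Q_def quot_Q_def by (rule quotientI[OF Theta_V[OF w]])
  moreover have "Phi Q k w \<noteq> class_Q Q k 0"
  proof
    assume eq: "Phi Q k w = class_Q Q k 0"
    have "Theta k w \<in> Phi Q k w"
      using Theta_V[OF w] by (simp add: Phi_def class_Q_def cong_Q_def V_Q_def)
    then have "Q dvd - Theta k w" unfolding eq by (simp add: class_Q_def cong_Q_def V_Q_def)
    then have "pullback (Theta k w) = 0" using Q_dvd_iff[OF Theta_V[OF w]] by simp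
    then show False using pullback_Theta_nonzero[OF w] by contradiction
  qed
  ultimately show ?thesis using w mem Theta by (intro bexI[of _ w]) (auto simp: Phi_def)
qed

end

section \<open>Representation of polynomials by multipoles\<close>

theorem theorem11:
  fixes Q P :: poly3 and d :: nat
  assumes "Q \<in> V 2" and "irreducible Q" and "total_deg P = d"
  shows
    "(\<exists>(c :: complex) (L :: nat \<Rightarrow> nat \<Rightarrow> poly3).
        (\<forall>k\<in>{1..d}. \<forall>l\<in>{1..k}. L k l \<in> V 1) \<and>
        (\<forall>v\<in>level_surface Q.
            eval P v = eval (Const c + (\<Sum>k\<in>{1..d}. \<Prod>l\<in>{1..k}. L k l)) v) \<and>
        (\<forall>k\<in>{1..d}. (\<Prod>l\<in>{1..k}. L k l) \<noteq> 0 \<longrightarrow>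
            (\<exists>w\<in>multipoles k. restrict (L k) {1..k} \<in> w \<and>
               Theta k w = (\<Prod>l\<in>{1..k}. L k l) \<and>
               Phi Q k w = class_Q Q k (\<Prod>l\<in>{1..k}. L k l) \<and>
               Phi Q k w \<in> quot_Q Q k - {class_Q Q k 0})))
     \<and> finite (representing_seqs Q P d)
     \<and> card (representing_seqs Q P d) \<le> (\<Prod>k\<in>{1..d}. odd_double_fact k)"
proof -
  obtain x y z \<gamma> e1 e2 e3 where "conic Q x y z \<gamma> e1 e2 e3"
    using irreducible_imp_conic[OF assms(1,2)] by blast
  then interpret conic Q x y z \<gamma> e1 e2 e3 .
  have "mono_degree m \<le> d" if "m \<in> Poly_Mapping.keys P" for m
    using that assms(3) unfolding total_deg_def by (metis Max_ge finite.insertI finite_imageI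
      finite_keys imageI insertI2)
  then obtain c L where L: "\<forall>k\<in>{1..d}. \<forall>l\<in>{1..k}. L k l \<in> V 1"
    and rep: "\<forall>v\<in>level_surface Q. eval P v = eval (Const c + (\<Sum>k\<in>{1..d}. \<Prod>l\<in>{1..k}. L k l)) v"
    using representation_exists by blast
  have "representing_seqs Q P d = seqs_representing (eval P) d"
    by (simp add: representing_seqs_def seqs_representing_def)
  then have "finite (representing_seqs Q P d)"
    "card (representing_seqs Q P d) \<le> (\<Prod>k\<in>{1..d}. odd_double_fact k)"
    using card_seqs_representing by simp_all
  then show ?thesis
    using L rep by (intro conjI exI[of _ c] exI[of _ L] ballI impI product_multipole) blast+
qed

end
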